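(* Let $n\ge 1$ and, for each $i\in[n]$, let $\mathcal{M}_i=(S_i,A_i,P_i,s_0^i)$ be a finite Markov decision process, $\pi^{\mathcal{S}}_i\in\Pi(\mathcal{M}_i)$ a stationary reference policy, and $R^{\mathcal{A}}_i\subseteq S_i$ a set of absorbing states; let $\nu_{\mathcal{A}}\ge 0$. Let $K^*$ be the optimal value of $$\inf_{(\pi^{\mathcal{A}}_1,\ldots,\pi^{\mathcal{A}}_n)\in \Pi(\mathcal{M}_1)\times\cdots\times\Pi(\mathcal{M}_n)}\ \max_{i\in[n]}\ \mathrm{KL}\big(\Gamma^{\pi^{\mathcal{A}}_i}\,\|\,\Gamma^{\pi^{\mathcal{S}}_i}\big)\quad\text{subject to}\quad \Pr(\exists i\in[n]: s_0^i\models\Diamond R^{\mathcal{A}}_i)\ge\nu_{\mathcal{A}},$$ where the probability is under the policies $\pi^{\mathcal{A}}_i$ executed independently by the agents. Let $\varepsilon>0$ and let $K_{\max}<\infty$ satisfy $K_{\max}\ge K^*$. Let $\overline{K}$ be the output of the bisection algorithm DeceptiveSynthesis (defined in the context) run with inputs $(\pi^{\mathcal{S}}_i,R^{\mathcal{A}}_i)_{i=1}^n$, $\nu_{\mathcal{A}}$, $K_{\max}$, $\varepsilon$. Then $\overline{K}<K^*+\varepsilon$.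
   Context: $[n]=\{1,\ldots,n\}$. A Markov decision process (MDP) $\mathcal{M}=(S,A,P,s_0)$ has state space $S$, action space $A$, transition probabilities $P(s,a,q)$ (probability of moving from $s$ to $q$ under action $a$), and initial state $s_0$; $A(s)$ is the (nonempty) set of actions available at $s$. $\mathrm{Succ}(s)$ is the set of $q$ such that $P(s,a,q)>0$ for some $a\in A(s)$; $s$ is absorbing if $\mathrm{Succ}(s)=\{s\}$. All state and action spaces are finite. A stationary policy is a map $\pi:S\times A\to[0,1]$ with $\sum_{a\in A(s)}\pi(s,a)=1$ for every $s$; $\Pi(\mathcal{M})$ is the set of stationary policies. Agent $i$ acts in $\mathcal{M}_i$ independently of the other agents. $\Gamma^{\pi}$ is the distribution induced by $\pi$ on the infinite state paths $s_0s_1s_2\ldots$ of the MDP. $\mathrm{KL}(P_1\|P_2)$ is the Kullback–Leibler divergence ($\sum_x P_1(x)\log(P_1(x)/P_2(x))$ for discrete distributions, $\int\log\frac{dP_1}{dP_2}\,dP_1$ in general, and $+\infty$ if $P_1$ is not absolutely continuous with respect to $P_2$). $\Pr(s_0\models\Diamond R)$ is the probability that the path visits $R$, and $\Pr(\exists i\in[n]:s_0^i\models\Diamond R_i)=1-\prod_{i=1}^n\big(1-\Pr(s_0^i\models\Diamond R_i)\big)$. For each $i$, let $C^{cl}_i$ be the union of the closed communicating classes of the Markov chain induced on $S_i$ by $\pi^{\mathcal{S}}_i$, and let $S_{d,i}=S_i\setminus(C^{cl}_i\cup R^{\mathcal{A}}_i)$. Write $\pi^{\mathcal{S}}_{s,q}=\sum_{a\in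 A_i(s)}P_i(s,a,q)\pi^{\mathcal{S}}_i(s,a)$, and, for a real vector $\mathbf{x}_i=(x_{s,a})_{s\in S_{d,i},a\in A_i(s)}$, $x_{s,q}=\sum_{a\in A_i(s)}x_{s,a}P_i(s,a,q)$. With $\mathbb{1}_{s_0^i}(s)=1$ if $s=s_0^i$ and $0$ otherwise, define $$\mathrm{KL}(\mathbf{x}_i,\pi^{\mathcal{S}}_i)=\sum_{s\in S_{d,i}}\sum_{q\in\mathrm{Succ}_i(s)}x_{s,q}\log\!\left(\frac{x_{s,q}}{\pi^{\mathcal{S}}_{s,q}\sum_{a'\in A_i(s)}x_{s,a'}}\right),$$ $$F(\mathbf{x}_i,s)=\sum_{a\in A_i(s)}x_{s,a}-\sum_{q\in S_{d,i}}x_{q,s}-\mathbb{1}_{s_0^i}(s),$$ $$\nu(\mathbf{x}_i,R_i)=\sum_{q\in R_i}\Big(\mathbb{1}_{s_0^i}(q)+\sum_{s\in S_{d,i}}x_{s,q}\Big),$$ with the conventions that a term with $x_{s,q}=0$ equals $0$ and a term with $x_{s,q}>0$ and $\pi^{\mathcal{S}}_{s,q}=0$ equals $+\infty$. For $K\ge 0$, $\mathrm{Reach}(\pi^{\mathcal{S}}_i,R^{\mathcal{A}}_i,K)$ denotes the supremum of $\nu(\mathbf{x}_i,R^{\mathcal{A}}_i)$ over $\mathbf{x}_i\ge 0$ satisfying $\mathrm{KL}(\mathbf{x}_i,\pi^{\mathcal{S}}_i)\le K$ and $F(\mathbf{x}_i,s)=0$ for all $s\in S_{d,i}$. Define $$\nu_\Delta(K)=1-\prod_{i=1}^n\big(1-\mathrm{Reach}(\pi^{\mathcal{S}}_i,R^{\mathcal{A}}_i,K)\big)-\nu_{\mathcal{A}}.$$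 Algorithm DeceptiveSynthesis: initialize $\underline{K}=0$, $\overline{K}=K_{\max}$. While $\overline{K}-\underline{K}\ge\varepsilon$: set $K=(\underline{K}+\overline{K})/2$, evaluate $\nu_\Delta(K)$ exactly; if $\nu_\Delta(K)<0$ set $\underline{K}=K$, otherwise (including $\nu_\Delta(K)=0$) set $\overline{K}=K$. Output the final $\overline{K}$. *)

theory Defs
  imports "HOL-Probability.Probability" "HOL-Library.While_Combinator"
begin

section \<open>Markov decision processes and stationary policies\<close>

text \<open>The transition probability \<open>P(s,a,q)\<close> is \<open>pmf (trans M s a) q\<close>. It is only meaningful
  for \<open>s \<in> states M\<close> and \<open>a \<in> avail M s\<close>.\<close>

record ('s, 'a) mdp =
  states :: "'s set"
  actions :: "'a set"
  avail :: "'s \<Rightarrow> 'a set"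
  trans :: "'s \<Rightarrow> 'a \<Rightarrow> 's pmf"
  init :: 's

definition finite_mdp :: "('s, 'a) mdp \<Rightarrow> bool" where
  "finite_mdp M \<longleftrightarrow>
     finite (states M) \<and> finite (actions M) \<and> init M \<in> states M \<and>
     (\<forall>s\<in>states M. avail M s \<noteq> {} \<and> avail M s \<subseteq> actions M \<and>
        (\<forall>a\<in>avail M s. set_pmf (trans M s a) \<subseteq> states M))"

definition Succ :: "('s, 'a) mdp \<Rightarrow> 's \<Rightarrow> 's set" where
  "Succ M s = {q \<in> states M. \<exists>a\<in>avail M s. pmf (trans M s a) q > 0}"

definition absorbing :: "('s, 'a) mdp \<Rightarrow> 's \<Rightarrow> bool" where
  "absorbing M s \<longleftrightarrow> Succ M s = {s}"

text \<open>A stationary policy assigns to each state a distribution on the available actions;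
  \<open>\<pi>(s,a)\<close> is \<open>pmf (\<pi> s) a\<close>.\<close>

definition policies :: "('s, 'a) mdp \<Rightarrow> ('s \<Rightarrow> 'a pmf) set" where
  "policies M = {\<pi>. \<forall>s\<in>states M. set_pmf (\<pi> s) \<subseteq> avail M s}"

definition policy_trans :: "('s, 'a) mdp \<Rightarrow> ('s \<Rightarrow> 'a pmf) \<Rightarrow> 's \<Rightarrow> 's \<Rightarrow> real" where
  "policy_trans M \<pi> s q = (\<Sum>a\<in>avail M s. pmf (trans M s a) q * pmf (\<pi> s) a)"

definition policy_kernel :: "('s, 'a) mdp \<Rightarrow> ('s \<Rightarrow> 'a pmf) \<Rightarrow> 's \<Rightarrow> 's pmf" where
  "policy_kernel M \<pi> s = bind_pmf (\<pi> s) (trans M s)"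

lemma pmf_policy_kernel:
  assumes "finite_mdp M" "\<pi> \<in> policies M" "s \<in> states M"
  shows "pmf (policy_kernel M \<pi> s) q = policy_trans M \<pi> s q"
proof -
  have fin: "finite (avail M s)"
    using assms(1,3) unfolding finite_mdp_def by (meson finite_subset)
  have sub: "set_pmf (\<pi> s) \<subseteq> avail M s"
    using assms(2,3) unfolding policies_def by blast
  show ?thesis
    unfolding policy_kernel_def policy_trans_def pmf_bind
    by (subst integral_measure_pmf_real[OF fin]) (use sub in auto)
qed

section \<open>Distribution on infinite paths\<close>

text \<open>The law of the time-homogeneous Markov chain with initial state \<open>s0\<close> and transition kernel
  \<open>K\<close>, obtained from the Ionescu-Tulcea theorem. Paths are functions \<open>nat \<Rightarrow> 's\<close>.\<close>

primrec chain_step :: "('s \<Rightarrow> 's pmf) \<Rightarrow> 's \<Rightarrow> nat \<Rightarrow> (nat \<Rightarrow> 's) \<Rightarrow> 's measure" where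
  "chain_step K s0 0 \<omega> = measure_pmf (return_pmf s0)"
| "chain_step K s0 (Suc t) \<omega> = measure_pmf (K (\<omega> t))"

interpretation chain: Ionescu_Tulcea "chain_step K s0" "\<lambda>_. count_space UNIV" for K s0
proof (rule Ionescu_Tulcea.intro)
  fix t
  show "chain_step K s0 t \<in> measurable (PiM {0..<t} (\<lambda>_. count_space UNIV))
      (subprob_algebra (count_space UNIV))"
  proof (cases t)
    case 0
    then have "chain_step K s0 t = (\<lambda>_. measure_pmf (return_pmf s0))" by auto
    then show ?thesis
      by (simp add: space_subprob_algebra prob_space_imp_subprob_space measure_pmf.prob_space_axioms)
  next
    case (Suc u)
    then have eq: "chain_step K s0 t = (\<lambda>\<omega>. measure_pmf (K (\<omega> u)))" by auto
    have "(\<lambda>\<omega>. \<omega> u) \<in> measurable (PiM {0..<t} (\<lambda>_. count_space UNIV)) (count_space UNIV)"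
      by (rule measurable_component_singleton) (simp add: Suc)
    then show ?thesis
      unfolding eq
      by (rule measurable_compose)
        (auto simp: space_subprob_algebra prob_space_imp_subprob_space measure_pmf.prob_space_axioms)
  qed
next
  fix t \<omega>
  show "prob_space (chain_step K s0 t \<omega>)"
    by (cases t) (simp_all add: measure_pmf.prob_space_axioms)
qed

definition chain_measure :: "('s \<Rightarrow> 's pmf) \<Rightarrow> 's \<Rightarrow> (nat \<Rightarrow> 's) measure" where
  "chain_measure K s0 = chain.PF.lim K s0"

definition path_measure :: "('s, 'a) mdp \<Rightarrow> ('s \<Rightarrow> 'a pmf) \<Rightarrow> (nat \<Rightarrow> 's) measure" where
  "path_measure M \<pi> = chain_measure (policy_kernel M \<pi>) (init M)"

lemma sets_chain_measure: "sets (chain_measure K s0) = sets (PiM UNIV (\<lambda>_. count_space UNIV))"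
  unfolding chain_measure_def by (rule chain.PF.sets_lim)

lemma space_path_measure: "space (path_measure M \<pi>) = UNIV"
  unfolding path_measure_def using sets_eq_imp_space_eq[OF sets_chain_measure]
  by (simp add: space_PiM)

lemma prob_space_path_measure: "prob_space (path_measure M \<pi>)"
proof -
  let ?K = "policy_kernel M \<pi>" and ?s0 = "init M" and ?X = "{\<lambda>_. undefined} :: (nat \<Rightarrow> 'a) set"
  interpret CI: prob_space "chain.CI ?K ?s0 {}"
    by (rule chain.PF.prob_space_P) auto
  have "emeasure (chain.PF.lim ?K ?s0) (prod_emb UNIV (\<lambda>_. count_space UNIV) {} ?X) =
      emeasure (chain.CI ?K ?s0 {}) ?X"
    by (rule chain.lim) (simp_all add: sets_PiM_empty)
  moreover have "prod_emb UNIV (\<lambda>_. count_space UNIV) {} ?X = UNIV"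
    by (auto simp: prod_emb_def space_PiM restrict_def)
  moreover have "space (chain.CI ?K ?s0 {}) = ?X"
    by (simp add: chain.CI_def space_PiM)
  ultimately show ?thesis
    using CI.emeasure_space_1 space_path_measure[of M \<pi>]
    by (intro prob_spaceI) (simp add: path_measure_def chain_measure_def)
qed

lemma emeasure_chain_C_cylinder:
  "emeasure (chain.C K s0 0 n (\<lambda>_. undefined)) (PiE {0..<n} (\<lambda>t. {p t})) =
     (\<Prod>t<n. emeasure (chain_step K s0 t p) {p t})"
proof (induction n)
  case 0
  then show ?case by (simp add: space_PiM sets_PiM_empty)
next
  case (Suc n)
  let ?N = "\<lambda>n. PiM {0..<n} (\<lambda>_. count_space (UNIV :: 'a set))"
  let ?X = "\<lambda>n. PiE {0..<n} (\<lambda>t. {p t})"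
  let ?C = "chain.C K s0 0 n (\<lambda>_. undefined)"
  have u: "(\<lambda>_. undefined) \<in> space (?N 0)" by (auto simp: space_PiM)
  have sets_X: "?X m \<in> sets (?N m)" for m
    by (rule sets_PiM_I_finite) auto
  have space_C: "space ?C = space (?N n)" and sets_C: "sets ?C = sets (?N n)"
    using chain.space_C[OF u, of K s0 n] chain.sets_C[OF u, of K s0 n] by simp_all
  have meas: "chain.eP K s0 n \<in> measurable ?C (subprob_algebra (?N (Suc n)))"
    using chain.measurable_eP by (simp add: measurable_cong_sets[OF sets_C refl])
  have step: "emeasure (chain.eP K s0 n \<omega>) (?X (Suc n)) =
      emeasure (chain_step K s0 n p) {p n} * indicator (?X n) \<omega>"
    if w: "\<omega> \<in> space (?N n)" for \<omega>
  proof -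
    have ext: "\<omega> \<in> extensional {0..<n}" using w by (simp add: space_PiM PiE_def)
    have pre: "(\<lambda>x. fun_upd \<omega> n x) -` ?X (Suc n) = (if \<omega> \<in> ?X n then {p n} else {})"
      using ext by (fastforce simp: PiE_iff extensional_def atLeastLessThanSuc split: if_splits)
    have "chain_step K s0 n \<omega> = chain_step K s0 n p" if "\<omega> \<in> ?X n"
      using that by (cases n) (auto simp: PiE_iff)
    then show ?thesis
      by (subst chain.emeasure_eP[OF w sets_X]) (auto simp: pre)
  qed
  have "emeasure (chain.C K s0 0 (Suc n) (\<lambda>_. undefined)) (?X (Suc n)) =
      (\<integral>\<^sup>+\<omega>. emeasure (chain.eP K s0 n \<omega>) (?X (Suc n)) \<partial>?C)"
    using emeasure_bind[OF _ meas sets_X] space_C u by auto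
  also have "\<dots> = (\<integral>\<^sup>+\<omega>. emeasure (chain_step K s0 n p) {p n} * indicator (?X n) \<omega> \<partial>?C)"
    by (intro nn_integral_cong step) (simp add: space_C)
  also have "\<dots> = emeasure (chain_step K s0 n p) {p n} * emeasure ?C (?X n)"
    by (rule nn_integral_cmult_indicator) (simp add: sets_C sets_X)
  finally show ?case by (simp add: Suc.IH mult.commute)
qed

lemma emeasure_chain_measure_cylinder:
  "emeasure (chain_measure K s0) {\<omega>. \<forall>t\<le>n. \<omega> t = p t} =
     indicator {s0} (p 0) * (\<Prod>t<n. ennreal (pmf (K (p t)) (p (Suc t))))"
proof -
  let ?X = "PiE {0..<Suc n} (\<lambda>t. {p t})"
  have X: "?X \<in> sets (PiM {0..<Suc n} (\<lambda>_. count_space UNIV))"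
    by (rule sets_PiM_I_finite) auto
  have emb: "prod_emb UNIV (\<lambda>_. count_space UNIV) {0..<Suc n} ?X = {\<omega>. \<forall>t\<le>n. \<omega> t = p t}"
    by (auto simp: prod_emb_def space_PiM PiE_iff less_Suc_eq_le)
  have triv: "prod_emb {0..<Suc n} (\<lambda>_. count_space UNIV) {0..<Suc n} ?X = ?X"
    using sets.sets_into_space[OF X] by (intro prod_emb_id) (simp add: space_PiM)
  have "emeasure (chain_measure K s0) {\<omega>. \<forall>t\<le>n. \<omega> t = p t} = emeasure (chain.CI K s0 {0..<Suc n}) ?X"
    unfolding chain_measure_def emb[symmetric] by (rule chain.lim[OF _ X]) simp
  also have "\<dots> = emeasure (chain.C K s0 0 (Suc n) (\<lambda>_. undefined)) ?X"
    using chain.emeasure_CI[OF order.refl X] unfolding triv .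
  also have "\<dots> = (\<Prod>t<Suc n. emeasure (chain_step K s0 t p) {p t})"
    by (rule emeasure_chain_C_cylinder)
  also have "\<dots> = emeasure (return_pmf s0) {p 0} * (\<Prod>t<n. emeasure (K (p t)) {p (Suc t)})"
    unfolding prod.lessThan_Suc_shift by simp
  also have "\<dots> = indicator {s0} (p 0) * (\<Prod>t<n. ennreal (pmf (K (p t)) (p (Suc t))))"
    by (simp add: emeasure_pmf_single indicator_def)
  finally show ?thesis .
qed

definition reach_prob :: "('s, 'a) mdp \<Rightarrow> ('s \<Rightarrow> 'a pmf) \<Rightarrow> 's set \<Rightarrow> real" where
  "reach_prob M \<pi> R = measure (path_measure M \<pi>) {\<omega>. \<exists>t. \<omega> t \<in> R}"

text \<open>Probability that at least one of the independent agents reaches its target set.\<close>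

definition team_reach_prob ::
  "nat \<Rightarrow> (nat \<Rightarrow> ('s, 'a) mdp) \<Rightarrow> (nat \<Rightarrow> 's \<Rightarrow> 'a pmf) \<Rightarrow> (nat \<Rightarrow> 's set) \<Rightarrow> real" where
  "team_reach_prob n M \<pi> R = 1 - (\<Prod>i\<in>{1..n}. 1 - reach_prob (M i) (\<pi> i) (R i))"

lemma team_reach_prob_eq_product:
  "team_reach_prob n M \<pi> R =
     measure (PiM {1..n} (\<lambda>i. path_measure (M i) (\<pi> i)))
       {\<omega> \<in> space (PiM {1..n} (\<lambda>i. path_measure (M i) (\<pi> i))). \<exists>i\<in>{1..n}. \<exists>t. \<omega> i t \<in> R i}"
proof -
  let ?G = "\<lambda>i. path_measure (M i) (\<pi> i)"
  let ?E = "\<lambda>i. {\<omega>. \<exists>t. \<omega> t \<in> R i}"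
  interpret G: prob_space "?G i" for i by (rule prob_space_path_measure)
  interpret P: finite_product_prob_space ?G "{1..n}" by unfold_locales simp
  have E: "?E i \<in> sets (?G i)" for i
  proof -
    have "{\<omega> \<in> space (PiM UNIV (\<lambda>_. count_space UNIV)). \<exists>t::nat. \<omega> t \<in> R i}
        \<in> sets (PiM UNIV (\<lambda>_. count_space UNIV))"
      by (intro sets.sets_Collect_countable_Ex sets_Collect_single) auto
    then show ?thesis
      unfolding path_measure_def sets_chain_measure by (simp add: space_PiM)
  qed
  have miss: "- ?E i \<in> sets (?G i)" for i
    using sets.compl_sets[OF E[of i]] by (simp add: space_path_measure Compl_eq_Diff_UNIV)
  have meas: "PiE {1..n} (\<lambda>i. - ?E i) \<in> sets (PiM {1..n} ?G)"
    using miss by (intro sets_PiM_I_finite) auto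
  have "{\<omega> \<in> space (PiM {1..n} ?G). \<exists>i\<in>{1..n}. \<exists>t. \<omega> i t \<in> R i} =
      space (PiM {1..n} ?G) - PiE {1..n} (\<lambda>i. - ?E i)"
    by (auto simp: space_PiM space_path_measure PiE_iff extensional_def)
  then have "measure (PiM {1..n} ?G) {\<omega> \<in> space (PiM {1..n} ?G). \<exists>i\<in>{1..n}. \<exists>t. \<omega> i t \<in> R i} =
      1 - measure (PiM {1..n} ?G) (PiE {1..n} (\<lambda>i. - ?E i))"
    using P.prob_compl[OF meas] by simp
  also have "measure (PiM {1..n} ?G) (PiE {1..n} (\<lambda>i. - ?E i)) = (\<Prod>i\<in>{1..n}. measure (?G i) (- ?E i))"
    by (rule P.prob_times) (rule miss)
  also have "\<dots> = (\<Prod>i\<in>{1..n}. 1 - reach_prob (M i) (\<pi> i) (R i))"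
    using G.prob_compl[OF E]
    by (intro prod.cong refl) (simp add: reach_prob_def space_path_measure Compl_eq_Diff_UNIV)
  finally show ?thesis
    by (simp add: team_reach_prob_def)
qed

section \<open>Kullback--Leibler divergence\<close>

text \<open>\<open>KL_divergence b Q P\<close> from the library has the reference measure as its first measure
  argument and is real-valued. For probability measures with \<open>P \<lless> Q\<close> the negative part of the
  log-density is always \<open>P\<close>-integrable, so non-integrability means that the divergence is
  \<open>\<infinity>\<close>.\<close>

definition KL_div :: "'x measure \<Rightarrow> 'x measure \<Rightarrow> ereal" where
  "KL_div P Q =
     (if absolutely_continuous Q P \<and> integrable P (entropy_density (exp 1) Q P)
      then ereal (KL_divergence (exp 1) Q P) else \<infinity>)"

definition optimal_KL ::
  "nat \<Rightarrow> (nat \<Rightarrow> ('s, 'a) mdp) \<Rightarrow> (nat \<Rightarrow> 's \<Rightarrow> 'a pmf) \<Rightarrow> (nat \<Rightarrow> 's set) \<Rightarrow> real \<Rightarrow> ereal" where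
  "optimal_KL n M \<pi>S R \<nu>A =
     (INF \<pi>A \<in> {\<pi>A. (\<forall>i\<in>{1..n}. \<pi>A i \<in> policies (M i)) \<and> team_reach_prob n M \<pi>A R \<ge> \<nu>A}.
        MAX i\<in>{1..n}. KL_div (path_measure (M i) (\<pi>A i)) (path_measure (M i) (\<pi>S i)))"

section \<open>The optimization problem in occupation variables\<close>

definition chain_edges :: "('s, 'a) mdp \<Rightarrow> ('s \<Rightarrow> 'a pmf) \<Rightarrow> ('s \<times> 's) set" where
  "chain_edges M \<pi> = {(s, q). s \<in> states M \<and> q \<in> states M \<and> policy_trans M \<pi> s q > 0}"

definition communicating :: "('s, 'a) mdp \<Rightarrow> ('s \<Rightarrow> 'a pmf) \<Rightarrow> ('s \<times> 's) set" where
  "communicating M \<pi> = {(s, q). s \<in> states M \<and> q \<in> states M \<and>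
     (s, q) \<in> (chain_edges M \<pi>)\<^sup>* \<and> (q, s) \<in> (chain_edges M \<pi>)\<^sup>*}"

definition closed_class_states :: "('s, 'a) mdp \<Rightarrow> ('s \<Rightarrow> 'a pmf) \<Rightarrow> 's set" where
  "closed_class_states M \<pi> =
     \<Union> {C \<in> states M // communicating M \<pi>. chain_edges M \<pi> `` C \<subseteq> C}"

definition decision_states :: "('s, 'a) mdp \<Rightarrow> ('s \<Rightarrow> 'a pmf) \<Rightarrow> 's set \<Rightarrow> 's set" where
  "decision_states M \<pi> R = states M - (closed_class_states M \<pi> \<union> R)"

definition flow :: "('s, 'a) mdp \<Rightarrow> ('s \<Rightarrow> 'a \<Rightarrow> real) \<Rightarrow> 's \<Rightarrow> 's \<Rightarrow> real" where
  "flow M x s q = (\<Sum>a\<in>avail M s. x s a * pmf (trans M s a) q)"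

definition KL_flow ::
  "('s, 'a) mdp \<Rightarrow> ('s \<Rightarrow> 'a pmf) \<Rightarrow> 's set \<Rightarrow> ('s \<Rightarrow> 'a \<Rightarrow> real) \<Rightarrow> ereal" where
  "KL_flow M \<pi> R x =
     (\<Sum>s\<in>decision_states M \<pi> R. \<Sum>q\<in>Succ M s.
        if flow M x s q = 0 then 0
        else if policy_trans M \<pi> s q = 0 then \<infinity>
        else ereal (flow M x s q *
          ln (flow M x s q / (policy_trans M \<pi> s q * (\<Sum>a\<in>avail M s. x s a)))))"

definition flow_balance ::
  "('s, 'a) mdp \<Rightarrow> ('s \<Rightarrow> 'a pmf) \<Rightarrow> 's set \<Rightarrow> ('s \<Rightarrow> 'a \<Rightarrow> real) \<Rightarrow> 's \<Rightarrow> real" where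
  "flow_balance M \<pi> R x s =
     (\<Sum>a\<in>avail M s. x s a) - (\<Sum>q\<in>decision_states M \<pi> R. flow M x q s) - indicator {init M} s"

definition flow_reach ::
  "('s, 'a) mdp \<Rightarrow> ('s \<Rightarrow> 'a pmf) \<Rightarrow> 's set \<Rightarrow> ('s \<Rightarrow> 'a \<Rightarrow> real) \<Rightarrow> real" where
  "flow_reach M \<pi> R x =
     (\<Sum>q\<in>R. indicator {init M} q + (\<Sum>s\<in>decision_states M \<pi> R. flow M x s q))"

definition feasible_flows ::
  "('s, 'a) mdp \<Rightarrow> ('s \<Rightarrow> 'a pmf) \<Rightarrow> 's set \<Rightarrow> real \<Rightarrow> ('s \<Rightarrow> 'a \<Rightarrow> real) set" where
  "feasible_flows M \<pi> R K =
     {x. (\<forall>s\<in>decision_states M \<pi> R. \<forall>a\<in>avail M s. x s a \<ge> 0) \<and>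
         KL_flow M \<pi> R x \<le> ereal K \<and>
         (\<forall>s\<in>decision_states M \<pi> R. flow_balance M \<pi> R x s = 0)}"

text \<open>For \<open>K \<ge> 0\<close> the supremum is over a nonempty set (the occupation measure of \<open>\<pi>\<close> is feasible)
  bounded by \<open>1\<close> (by flow conservation), so the real-valued supremum is meaningful.\<close>

definition Reach :: "('s, 'a) mdp \<Rightarrow> ('s \<Rightarrow> 'a pmf) \<Rightarrow> 's set \<Rightarrow> real \<Rightarrow> real" where
  "Reach M \<pi> R K = (SUP x\<in>feasible_flows M \<pi> R K. flow_reach M \<pi> R x)"

definition reach_gap ::
  "nat \<Rightarrow> (nat \<Rightarrow> ('s, 'a) mdp) \<Rightarrow> (nat \<Rightarrow> 's \<Rightarrow> 'a pmf) \<Rightarrow> (nat \<Rightarrow> 's set) \<Rightarrow> real \<Rightarrow> real \<Rightarrow> real" where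
  "reach_gap n M \<pi>S R \<nu>A K = 1 - (\<Prod>i\<in>{1..n}. 1 - Reach (M i) (\<pi>S i) (R i) K) - \<nu>A"

section \<open>Bisection\<close>

definition bisection_continue :: "real \<Rightarrow> real \<times> real \<Rightarrow> bool" where
  "bisection_continue \<epsilon> = (\<lambda>(lo, hi). hi - lo \<ge> \<epsilon>)"

definition bisection_step :: "(real \<Rightarrow> real) \<Rightarrow> real \<times> real \<Rightarrow> real \<times> real" where
  "bisection_step f = (\<lambda>(lo, hi). let K = (lo + hi) / 2 in if f K < 0 then (K, hi) else (lo, K))"

definition deceptive_synthesis ::
  "nat \<Rightarrow> (nat \<Rightarrow> ('s, 'a) mdp) \<Rightarrow> (nat \<Rightarrow> 's \<Rightarrow> 'a pmf) \<Rightarrow> (nat \<Rightarrow> 's set) \<Rightarrow>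
     real \<Rightarrow> real \<Rightarrow> real \<Rightarrow> real" where
  "deceptive_synthesis n M \<pi>S R \<nu>A Kmax \<epsilon> =
     snd (while (bisection_continue \<epsilon>) (bisection_step (reach_gap n M \<pi>S R \<nu>A)) (0, Kmax))"

lemma bisection_terminates:
  assumes "\<epsilon> > 0"
  shows "\<exists>r. while_option (bisection_continue \<epsilon>) (bisection_step f) s = Some r"
proof (rule measure_while_option_Some[where P = "\<lambda>_. True" and f = "\<lambda>(lo, hi). nat \<lfloor>log 2 ((hi - lo) / \<epsilon>) + 1\<rfloor>"])
  fix s :: "real \<times> real"
  obtain lo hi where s: "s = (lo, hi)" by force
  assume "bisection_continue \<epsilon> s"
  then have ge: "hi - lo \<ge> \<epsilon>" by (simp add: s bisection_continue_def)
  obtain lo' hi' where s': "bisection_step f s = (lo', hi')" by force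
  then have half: "hi' - lo' = (hi - lo) / 2"
    by (auto simp: s bisection_step_def Let_def field_simps split: if_splits)
  have "log 2 ((hi' - lo') / \<epsilon>) = log 2 ((hi - lo) / \<epsilon>) - 1"
    using ge assms by (simp add: half log_divide log_mult)
  moreover have "log 2 ((hi - lo) / \<epsilon>) \<ge> 0"
    using ge assms by simp
  ultimately show "True \<and> (case bisection_step f s of (lo, hi) \<Rightarrow> nat \<lfloor>log 2 ((hi - lo) / \<epsilon>) + 1\<rfloor>)
      < (case s of (lo, hi) \<Rightarrow> nat \<lfloor>log 2 ((hi - lo) / \<epsilon>) + 1\<rfloor>)"
    using s' unfolding s by simp
qed simp

end

theory Submission
  imports Defs
begin

text \<open>The lower end of the bisection interval moves up to \<open>K\<close> only if the evaluated gap at \<open>K\<close> is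
  negative. Hence it suffices that the gap is nonnegative at every \<open>K\<close> above the optimal value \<open>K*\<close>: then
  the lower end stays below \<open>K*\<close>, and on termination the upper end exceeds it by less than \<open>\<epsilon>\<close>
  (\<open>bisection_upper_bound\<close>). For \<open>K\<close> above \<open>K*\<close> there are policies that meet the reachability
  constraint with all divergences below \<open>K\<close>, so everything reduces to one agent: a policy \<open>\<pi>A\<close> whose
  path law has divergence at most \<open>K\<close> from the reference law reaches the target with probability at
  most \<open>Reach\<close> at \<open>K\<close> (\<open>reach_prob_le_Reach_le_1\<close>).

  For one agent, fix a horizon \<open>T\<close>. Let the agent follow \<open>\<pi>A\<close> during the first \<open>T\<close> steps and the reference
  policy afterwards. The expected visits to the decision states form a feasible flow
  (\<open>feasible_flow_attaining_occ\<close>). They are finite since decision states are transient under the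
  reference policy, which amounts to the solvability of a linear system
  (\<open>occupation_equation_solvable\<close>). The visits after time \<open>T\<close> do not contribute to the divergence of the
  flow, by the log-sum inequality, so that divergence is at most the relative entropy of the first \<open>T\<close>
  transitions (\<open>KL_flow_switched_flow_le\<close>), which in turn is at most that of the infinite paths
  (\<open>finite_horizon_KL_le\<close>). The flow reaches the target with at least the probability that \<open>\<pi>A\<close> has
  done so by time \<open>T\<close>, and \<open>Reach\<close> is a supremum, so \<open>T\<close> may tend to infinity.

  Finiteness of the divergence enters a second time through absolute continuity: wherever \<open>\<pi>A\<close>
  can be, it uses only transitions of the reference policy. In particular it cannot leave the
  closed classes of the reference policy once it is there, which makes the flow balance hold.\<close>

section \<open>A variational lower bound for the divergence\<close>

text \<open>The easy half of the Donsker--Varadhan variational formula. With \<open>f = dP/dQ\<close> the pointwise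
  bound \<open>ln (g/f) \<le> g/f - 1\<close> integrates to \<open>E\<^sub>P ln g - E\<^sub>P ln f \<le> E\<^sub>Q g - 1 \<le> 0\<close>. It turns every
  subprobability density \<open>g\<close> that depends on finitely many coordinates into a lower bound for the
  divergence of the full path laws, which is how data processing enters below.\<close>
lemma integral_ln_le_KL_div:
  assumes P: "prob_space P" and Q: "prob_space Q" and sets: "sets P = sets Q"
    and g[measurable]: "g \<in> borel_measurable Q" and g_nonneg: "\<And>x. g x \<ge> 0"
    and mass: "(\<integral>\<^sup>+x. ennreal (g x) \<partial>Q) \<le> 1"
    and pos: "AE x in P. g x > 0"
    and int: "integrable P (\<lambda>x. ln (g x))"
  shows "ereal (\<integral>x. ln (g x) \<partial>P) \<le> KL_div P Q"
proof (cases "absolutely_continuous Q P \<and> integrable P (entropy_density (exp 1) Q P)")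
  case True
  then have ac: "absolutely_continuous Q P" and ent: "integrable P (entropy_density (exp 1) Q P)"
    by auto
  interpret P: prob_space P by fact
  interpret Q: prob_space Q by fact
  note sets[measurable_cong]
  define f where "f = (\<lambda>x. enn2real (RN_deriv Q P x))"
  have f[measurable]: "f \<in> borel_measurable Q"
    unfolding f_def by measurable
  have RN_fin: "AE x in Q. RN_deriv Q P x \<noteq> \<infinity>"
    using Q.RN_deriv_finite[OF P.sigma_finite_measure_axioms ac sets] .
  have dens: "density Q (\<lambda>x. ennreal (f x)) = P"
  proof -
    have "density Q (\<lambda>x. ennreal (f x)) = density Q (RN_deriv Q P)"
      by (rule density_cong) (use RN_fin in \<open>auto simp: f_def less_top\<close>)
    also have "\<dots> = P" by (rule Q.density_RN_deriv[OF ac sets])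
    finally show ?thesis .
  qed
  have f_nonneg: "f x \<ge> 0" for x by (simp add: f_def)
  have f_pos: "AE x in P. f x > 0"
    by (subst dens[symmetric], subst AE_density) auto
  have ratio: "(\<integral>\<^sup>+x. ennreal (g x / f x) \<partial>P) \<le> 1"
  proof -
    have "(\<integral>\<^sup>+x. ennreal (g x / f x) \<partial>P) = (\<integral>\<^sup>+x. ennreal (f x) * ennreal (g x / f x) \<partial>Q)"
      by (subst dens[symmetric], subst nn_integral_density) auto
    also have "\<dots> \<le> (\<integral>\<^sup>+x. ennreal (g x) \<partial>Q)"
    proof (rule nn_integral_mono)
      fix x
      show "ennreal (f x) * ennreal (g x / f x) \<le> ennreal (g x)"
        using f_nonneg[of x] g_nonneg[of x]
        by (cases "f x = 0") (auto simp flip: ennreal_mult)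
    qed
    finally show ?thesis using mass by simp
  qed
  have ratio_int: "integrable P (\<lambda>x. g x / f x)"
    using ratio f_nonneg g_nonneg
    by (intro integrableI_nonneg) (auto simp: less_top[symmetric] top_unique)
  have ratio_le: "(\<integral>x. g x / f x \<partial>P) \<le> 1"
    using ratio f_nonneg g_nonneg
    by (subst (asm) nn_integral_eq_integral[OF ratio_int]) auto
  have ent_eq: "entropy_density (exp 1) Q P = (\<lambda>x. ln (f x))"
    by (auto simp: entropy_density_def f_def log_def comp_def)
  have "(\<integral>x. ln (g x) \<partial>P) \<le> (\<integral>x. ln (f x) + (g x / f x - 1) \<partial>P)"
  proof (rule integral_mono_AE[OF int])
    show "integrable P (\<lambda>x. ln (f x) + (g x / f x - 1))"
      using ent ratio_int by (auto simp: ent_eq)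
    show "AE x in P. ln (g x) \<le> ln (f x) + (g x / f x - 1)"
      using pos f_pos
    proof eventually_elim
      case (elim x)
      then have "ln (g x / f x) \<le> g x / f x - 1" by (intro ln_le_minus_one) auto
      then show ?case using elim by (simp add: ln_div)
    qed
  qed
  also have "\<dots> = (\<integral>x. ln (f x) \<partial>P) + ((\<integral>x. g x / f x \<partial>P) - 1)"
    using ent ratio_int by (simp add: ent_eq P.prob_space)
  also have "\<dots> \<le> (\<integral>x. ln (f x) \<partial>P)"
    using ratio_le by simp
  finally show ?thesis
    using True by (simp add: KL_div_def KL_divergence_def ent_eq)
qed (auto simp: KL_div_def)

lemma KL_div_nonneg:
  assumes "prob_space P" "prob_space Q" "sets P = sets Q"
  shows "0 \<le> KL_div P Q"
proof -
  interpret Q: prob_space Q by fact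
  show ?thesis
    using integral_ln_le_KL_div[OF assms, of "\<lambda>_. 1"]
    by (simp add: Q.emeasure_space_1 zero_ereal_def)
qed

section \<open>Markov chains on a finite state space\<close>

locale finite_chain =
  fixes K :: "'s \<Rightarrow> 's pmf" and s0 :: 's and S :: "'s set"
  assumes finite_S: "finite S" and s0_in_S: "s0 \<in> S"
    and K_in_S: "\<And>s. s \<in> S \<Longrightarrow> set_pmf (K s) \<subseteq> S"
begin

abbreviation Z where "Z \<equiv> chain_measure K s0"

definition occ :: "nat \<Rightarrow> 's \<Rightarrow> real" where
  "occ t s = measure Z {\<omega>. \<omega> t = s}"

lemma sum_K: "s \<in> S \<Longrightarrow> (\<Sum>q\<in>S. pmf (K s) q) = 1"
  using K_in_S finite_S by (intro sum_pmf_eq_1) auto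

lemma space_Z: "space Z = UNIV"
  using sets_eq_imp_space_eq[OF sets_chain_measure] by (simp add: space_PiM)

lemma measurable_coord[measurable]: "(\<lambda>\<omega>. \<omega> t) \<in> measurable Z (count_space UNIV)"
  by (subst measurable_cong_sets[OF sets_chain_measure refl]) simp

lemma sets_coord: "{\<omega>. \<omega> t = s} \<in> sets Z"
  using measurable_sets[OF measurable_coord, of "{s}" t] by (simp add: space_Z vimage_def)

lemma sets_cylinder: "{\<omega>. \<forall>t\<le>n. \<omega> t = p t} \<in> sets Z"
proof -
  have "{\<omega>. \<forall>t\<le>n. \<omega> t = p t} = (\<Inter>t\<in>{..n}. {\<omega>. \<omega> t = p t})" by auto
  also have "\<dots> \<in> sets Z" using sets_coord by (intro sets.finite_INT) auto
  finally show ?thesis .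
qed

lemma measure_cylinder:
  "measure Z {\<omega>. \<forall>t\<le>n. \<omega> t = p t} = indicator {s0} (p 0) * (\<Prod>t<n. pmf (K (p t)) (p (Suc t)))"
  unfolding measure_def emeasure_chain_measure_cylinder
  by (simp add: prod_ennreal indicator_def prod_nonneg)

lemma prob_space_Z: "prob_space Z"
proof -
  \<comment> \<open>Every kernel is that of a decision process with a single action.\<close>
  let ?M = "\<lparr>states = S, actions = {()}, avail = \<lambda>_. {()}, trans = \<lambda>s _. K s, init = s0\<rparr>"
  have "policy_kernel ?M (\<lambda>_. return_pmf ()) = K"
    by (auto simp: policy_kernel_def bind_return_pmf)
  then show ?thesis
    using prob_space_path_measure[of ?M "\<lambda>_. return_pmf ()"] by (simp add: path_measure_def)
qed

sublocale Z: prob_space Z by (rule prob_space_Z)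

lemma measure_cylinder_Suc:
  "measure Z {\<omega>. (\<forall>t\<le>n. \<omega> t = p t) \<and> \<omega> (Suc n) = q} =
     measure Z {\<omega>. \<forall>t\<le>n. \<omega> t = p t} * pmf (K (p n)) q"
proof -
  let ?p = "p(Suc n := q)"
  have "{\<omega>. (\<forall>t\<le>n. \<omega> t = p t) \<and> \<omega> (Suc n) = q} = {\<omega>. \<forall>t\<le>Suc n. \<omega> t = ?p t}"
    by (auto simp: le_Suc_eq)
  moreover have "(\<Prod>t<n. pmf (K (?p t)) (?p (Suc t))) = (\<Prod>t<n. pmf (K (p t)) (p (Suc t)))"
    by (intro prod.cong) auto
  ultimately show ?thesis by (simp only: measure_cylinder) simp
qed

abbreviation paths :: "nat \<Rightarrow> (nat \<Rightarrow> 's) set" where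
  "paths n \<equiv> PiE {..n} (\<lambda>_. S)"

lemma finite_paths: "finite (paths n)"
  by (intro finite_PiE) (auto simp: finite_S)

lemma disjoint_cylinders: "disjoint_family_on (\<lambda>p. {\<omega>. \<forall>t\<le>n. \<omega> t = p t}) (paths n)"
proof (unfold disjoint_family_on_def, safe)
  fix p p' \<omega> assume "p \<in> paths n" "p' \<in> paths n" and ne: "p \<noteq> p'"
    and "\<forall>t\<le>n. \<omega> t = p t" "\<forall>t\<le>n. \<omega> t = p' t"
  then have "p = p'" by (intro PiE_ext[of p "{..n}" _ p']) auto
  with ne show "\<omega> \<in> {}" by simp
qed

text \<open>One step of the Markov property. The restriction to paths that have stayed in \<open>S\<close> makes the event a
  \<^emph>\<open>finite\<close> disjoint union of cylinders, whose masses are explicit products; that the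
  restriction only removes a null set is a consequence, see \<open>AE_confined\<close> below.\<close>
lemma measure_confined_step:
  "measure Z {\<omega>. (\<forall>t\<le>n. \<omega> t \<in> S) \<and> \<omega> n = s \<and> \<omega> (Suc n) = q} =
     measure Z {\<omega>. (\<forall>t\<le>n. \<omega> t \<in> S) \<and> \<omega> n = s} * pmf (K s) q"
proof -
  let ?I = "{p \<in> paths n. p n = s}"
  let ?E = "\<lambda>p. {\<omega>. \<forall>t\<le>n. \<omega> t = p t}"
  let ?E' = "\<lambda>p. {\<omega>. (\<forall>t\<le>n. \<omega> t = p t) \<and> \<omega> (Suc n) = q}"
  have fin: "finite ?I" using finite_paths by simp
  have E': "?E' p \<in> sets Z" for p
    unfolding Collect_conj_eq by (intro sets.Int sets_cylinder sets_coord)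
  have dis: "disjoint_family_on ?E ?I" "disjoint_family_on ?E' ?I"
    using disjoint_cylinders[of n] unfolding disjoint_family_on_def by auto
  have U: "{\<omega>. (\<forall>t\<le>n. \<omega> t \<in> S) \<and> \<omega> n = s} = (\<Union>p\<in>?I. ?E p)"
  proof (intro equalityI subsetI)
    fix \<omega> assume "\<omega> \<in> {\<omega>. (\<forall>t\<le>n. \<omega> t \<in> S) \<and> \<omega> n = s}"
    then have "restrict \<omega> {..n} \<in> ?I" and "\<omega> \<in> ?E (restrict \<omega> {..n})" by auto
    then show "\<omega> \<in> (\<Union>p\<in>?I. ?E p)" by blast
  qed (auto simp: PiE_iff)
  have U': "{\<omega>. (\<forall>t\<le>n. \<omega> t \<in> S) \<and> \<omega> n = s \<and> \<omega> (Suc n) = q} = (\<Union>p\<in>?I. ?E' p)"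
  proof -
    have "{\<omega>. (\<forall>t\<le>n. \<omega> t \<in> S) \<and> \<omega> n = s \<and> \<omega> (Suc n) = q} =
        {\<omega>. (\<forall>t\<le>n. \<omega> t \<in> S) \<and> \<omega> n = s} \<inter> {\<omega>. \<omega> (Suc n) = q}" by blast
    also have "\<dots> = (\<Union>p\<in>?I. ?E' p)" unfolding U by blast
    finally show ?thesis .
  qed
  have "measure Z (\<Union>p\<in>?I. ?E' p) = (\<Sum>p\<in>?I. measure Z (?E' p))"
    using fin E' dis by (intro Z.finite_measure_finite_Union) auto
  also have "\<dots> = (\<Sum>p\<in>?I. measure Z (?E p) * pmf (K s) q)"
    by (intro sum.cong refl) (simp add: measure_cylinder_Suc)
  also have "\<dots> = measure Z (\<Union>p\<in>?I. ?E p) * pmf (K s) q"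
    using fin sets_cylinder dis
    by (subst Z.finite_measure_finite_Union) (auto simp: sum_distrib_right)
  finally show ?thesis unfolding U U' .
qed

lemma sets_confined: "{\<omega>. \<forall>t\<le>n. \<omega> t \<in> S} \<in> sets Z"
proof -
  have "{\<omega>. \<forall>t\<le>n. \<omega> t \<in> S} = (\<Inter>t\<in>{..n}. \<Union>s\<in>S. {\<omega>. \<omega> t = s})" by auto
  also have "\<dots> \<in> sets Z"
    using sets_coord finite_S by (intro sets.finite_INT sets.finite_UN) auto
  finally show ?thesis .
qed

lemma measure_confined: "measure Z {\<omega>. \<forall>t\<le>n. \<omega> t \<in> S} = 1"
proof (induction n)
  case 0
  have "measure Z {\<omega>. \<forall>t\<le>0. \<omega> t = s0} \<le> measure Z {\<omega>. \<forall>t\<le>0. \<omega> t \<in> S}"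
    using s0_in_S sets_confined[of 0] by (intro Z.finite_measure_mono) auto
  then show ?case
    using measure_cylinder[of 0 "\<lambda>_. s0"] Z.prob_le_1[of "{\<omega>. \<forall>t\<le>0. \<omega> t \<in> S}"]
    by (intro antisym) auto
next
  case (Suc n)
  let ?E = "\<lambda>s. {\<omega>. (\<forall>t\<le>n. \<omega> t \<in> S) \<and> \<omega> n = s}"
  let ?E' = "\<lambda>s q. {\<omega>. (\<forall>t\<le>n. \<omega> t \<in> S) \<and> \<omega> n = s \<and> \<omega> (Suc n) = q}"
  have E: "?E s \<in> sets Z" and E': "?E' s q \<in> sets Z" for s q
    unfolding Collect_conj_eq by (intro sets.Int sets_confined sets_coord)+
  have "{\<omega>. \<forall>t\<le>Suc n. \<omega> t \<in> S} = (\<Union>(s, q)\<in>S \<times> S. ?E' s q)"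
    by (auto simp: le_Suc_eq)
  then have "measure Z {\<omega>. \<forall>t\<le>Suc n. \<omega> t \<in> S} =
      measure Z (\<Union>(s, q)\<in>S \<times> S. ?E' s q)" by (rule arg_cong)
  also have "\<dots> = (\<Sum>(s, q)\<in>S \<times> S. measure Z (?E' s q))"
    unfolding case_prod_beta
  proof (rule Z.finite_measure_finite_Union)
    show "(\<lambda>x. ?E' (fst x) (snd x)) ` (S \<times> S) \<subseteq> sets Z" using E' by blast
  qed (auto simp: disjoint_family_on_def finite_S)
  also have "\<dots> = (\<Sum>s\<in>S. \<Sum>q\<in>S. measure Z (?E s) * pmf (K s) q)"
    by (simp only: measure_confined_step sum.cartesian_product[symmetric])
  also have "\<dots> = (\<Sum>s\<in>S. measure Z (?E s))"
    by (simp add: sum_distrib_left[symmetric] sum_K)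
  also have "\<dots> = measure Z (\<Union>s\<in>S. ?E s)"
  proof (rule Z.finite_measure_finite_Union[symmetric])
    show "?E ` S \<subseteq> sets Z" using E by blast
  qed (auto simp: disjoint_family_on_def finite_S)
  also have "(\<Union>s\<in>S. ?E s) = {\<omega>. \<forall>t\<le>n. \<omega> t \<in> S}" by auto
  finally show ?case using Suc.IH by simp
qed

lemma AE_confined: "AE \<omega> in Z. \<forall>t. \<omega> t \<in> S"
proof -
  have "AE \<omega> in Z. \<forall>t\<le>n. \<omega> t \<in> S" for n
    using Z.AE_prob_1[OF measure_confined[of n]] unfolding mem_Collect_eq .
  then have "AE \<omega> in Z. \<forall>n. \<forall>t\<le>n. \<omega> t \<in> S" unfolding AE_all_countable by blast
  then show ?thesis by eventually_elim auto
qed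

lemma sets_pair: "{\<omega>. \<omega> t = s \<and> \<omega> (Suc t) = q} \<in> sets Z"
  unfolding Collect_conj_eq by (intro sets.Int sets_coord)

lemma measure_pair: "measure Z {\<omega>. \<omega> t = s \<and> \<omega> (Suc t) = q} = occ t s * pmf (K s) q"
proof -
  have c1: "measure Z {\<omega>. \<omega> t = s \<and> \<omega> (Suc t) = q} =
      measure Z ({\<omega>. \<forall>u\<le>t. \<omega> u \<in> S} \<inter> {\<omega>. \<omega> t = s \<and> \<omega> (Suc t) = q})"
    by (rule Z.finite_measure_eq_AE[OF _ sets_pair sets.Int[OF sets_confined sets_pair]],
        use AE_confined in eventually_elim) simp
  have c2: "occ t s = measure Z ({\<omega>. \<forall>u\<le>t. \<omega> u \<in> S} \<inter> {\<omega>. \<omega> t = s})"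
    unfolding occ_def
    by (rule Z.finite_measure_eq_AE[OF _ sets_coord sets.Int[OF sets_confined sets_coord]],
        use AE_confined in eventually_elim) simp
  show ?thesis
    using measure_confined_step[of t s q] unfolding c1 c2 by (simp add: Int_def)
qed

lemma occ_nonneg: "0 \<le> occ t s" by (simp add: occ_def)

lemma occ_0: "occ 0 s = indicator {s0} s"
  using measure_cylinder[of 0 "\<lambda>_. s"] by (simp add: occ_def)

text \<open>The state type may be uncountable, and then a function of two coordinates need not be measurable for
  the product of discrete sigma-algebras. Vanishing outside \<open>S \<times> S\<close> makes it a finite combination of
  indicators.\<close>
lemma pair_function_eq_sum:
  fixes h :: "'s \<Rightarrow> 's \<Rightarrow> real"
  assumes "\<And>s q. s \<notin> S \<or> q \<notin> S \<Longrightarrow> h s q = 0"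
  shows "h (\<omega> t) (\<omega> (Suc t)) =
    (\<Sum>s\<in>S. \<Sum>q\<in>S. indicator {\<omega>. \<omega> t = s \<and> \<omega> (Suc t) = q} \<omega> * h s q)"
proof -
  have "(\<Sum>s\<in>S. \<Sum>q\<in>S. indicator {\<omega>. \<omega> t = s \<and> \<omega> (Suc t) = q} \<omega> * h s q) =
      (\<Sum>s\<in>S. if s = \<omega> t then (\<Sum>q\<in>S. if q = \<omega> (Suc t) then h s q else 0) else 0)"
    by (intro sum.cong refl) (auto simp: indicator_def intro!: sum.cong)
  then show ?thesis
    using finite_S assms by auto
qed

lemma has_integral_pair:
  fixes h :: "'s \<Rightarrow> 's \<Rightarrow> real"
  assumes "\<And>s q. s \<notin> S \<or> q \<notin> S \<Longrightarrow> h s q = 0"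
  shows "has_bochner_integral Z (\<lambda>\<omega>. h (\<omega> t) (\<omega> (Suc t)))
     (\<Sum>s\<in>S. \<Sum>q\<in>S. occ t s * pmf (K s) q * h s q)"
proof -
  have "(\<lambda>\<omega>. h (\<omega> t) (\<omega> (Suc t))) =
      (\<lambda>\<omega>. \<Sum>s\<in>S. \<Sum>q\<in>S. indicator {\<omega>. \<omega> t = s \<and> \<omega> (Suc t) = q} \<omega> * h s q)"
    by (intro ext pair_function_eq_sum assms)
  then show ?thesis
    unfolding measure_pair[symmetric]
    by (simp only:) (intro has_bochner_integral_sum has_bochner_integral_mult_left
        has_bochner_integral_real_indicator sets_pair, simp add: less_top[symmetric])
qed

lemma occ_Suc: "occ (Suc t) q = (\<Sum>s\<in>S. occ t s * pmf (K s) q)"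
proof -
  let ?E = "\<lambda>s. {\<omega>. \<omega> t = s \<and> \<omega> (Suc t) = q}"
  note E = sets_pair[of t _ q]
  have "occ (Suc t) q = measure Z (\<Union>s\<in>S. ?E s)"
    unfolding occ_def
    by (rule Z.finite_measure_eq_AE[OF _ sets_coord sets.finite_UN[OF finite_S E]],
        use AE_confined in eventually_elim) auto
  also have "\<dots> = (\<Sum>s\<in>S. measure Z (?E s))"
  proof (rule Z.finite_measure_finite_Union)
    show "?E ` S \<subseteq> sets Z" using E by blast
  qed (auto simp: disjoint_family_on_def finite_S)
  finally show ?thesis by (simp add: measure_pair)
qed

lemma AE_pair_positive: "AE \<omega> in Z. \<forall>t. 0 < occ t (\<omega> t) * pmf (K (\<omega> t)) (\<omega> (Suc t))"
proof -
  have "AE \<omega> in Z. \<forall>s\<in>S. \<forall>q\<in>S. \<omega> t = s \<and> \<omega> (Suc t) = q \<longrightarrow> 0 < occ t s * pmf (K s) q" for t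
  proof (intro AE_finite_allI finite_S)
    fix s q
    show "AE \<omega> in Z. \<omega> t = s \<and> \<omega> (Suc t) = q \<longrightarrow> 0 < occ t s * pmf (K s) q"
    proof (cases "occ t s * pmf (K s) q = 0")
      case True
      then have "{\<omega>. \<omega> t = s \<and> \<omega> (Suc t) = q} \<in> null_sets Z"
        using measure_pair[of t s q] sets_pair[of t s q]
        by (simp add: null_sets_def Z.emeasure_eq_measure)
      then show ?thesis
        by (rule AE_I') (auto simp: True)
    next
      case False
      then show ?thesis by (simp add: less_le occ_nonneg)
    qed
  qed
  then have "AE \<omega> in Z. \<forall>t. \<forall>s\<in>S. \<forall>q\<in>S. \<omega> t = s \<and> \<omega> (Suc t) = q \<longrightarrow> 0 < occ t s * pmf (K s) q"
    unfolding AE_all_countable by blast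
  with AE_confined show ?thesis by eventually_elim blast
qed

end

section \<open>Divergence of two chains over a finite horizon\<close>

locale finite_chain_pair =
  A: finite_chain A s0 S + B: finite_chain B s0 S
  for A B :: "'s \<Rightarrow> 's pmf" and s0 S +
  assumes ac: "absolutely_continuous B.Z A.Z"
begin

text \<open>A transition that \<open>B\<close> never makes is a null event for \<open>B\<close>, hence for \<open>A\<close>. The kernel of \<open>A\<close> itself
  need not be dominated by that of \<open>B\<close>: nothing is known at states that \<open>A\<close> does not visit.\<close>
lemma support_subset:
  assumes "A.occ t s * pmf (A s) q \<noteq> 0"
  shows "pmf (B s) q \<noteq> 0"
proof
  assume "pmf (B s) q = 0"
  then have "{\<omega>. \<omega> t = s \<and> \<omega> (Suc t) = q} \<in> null_sets B.Z"
    using B.measure_pair[of t s q] B.sets_pair[of t s q]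
    by (simp add: null_sets_def B.Z.emeasure_eq_measure)
  then have "{\<omega>. \<omega> t = s \<and> \<omega> (Suc t) = q} \<in> null_sets A.Z"
    using ac by (auto simp: absolutely_continuous_def)
  then have "A.occ t s * pmf (A s) q = 0"
    using A.measure_pair[of t s q] by (simp add: null_sets_def A.Z.emeasure_eq_measure)
  with assms show False by simp
qed

text \<open>The value \<open>0\<close> outside \<open>S\<close> costs only a null set and keeps functions of the ratio measurable: since
  \<open>ln 0 = 0\<close> here, its logarithm vanishes outside \<open>S\<close> too.\<close>
definition ratio :: "'s \<Rightarrow> 's \<Rightarrow> real" where
  "ratio s q = (if s \<in> S \<and> q \<in> S then pmf (A s) q / pmf (B s) q else 0)"

definition likelihood :: "nat \<Rightarrow> (nat \<Rightarrow> 's) \<Rightarrow> real" where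
  "likelihood T \<omega> = (\<Prod>t<T. ratio (\<omega> t) (\<omega> (Suc t)))"

lemma ratio_nonneg: "0 \<le> ratio s q"
  by (simp add: ratio_def)

text \<open>Cell by cell on the finite partition into paths of length \<open>T\<close>, the likelihood times the \<open>B\<close>-mass is at
  most the \<open>A\<close>-mass; it is smaller where \<open>B\<close> forbids a transition that \<open>A\<close> allows.\<close>
lemma likelihood_mass: "(\<integral>\<^sup>+\<omega>. ennreal (likelihood T \<omega>) \<partial>B.Z) \<le> 1"
proof -
  let ?E = "\<lambda>p. {\<omega>. \<forall>t\<le>T. \<omega> t = p t}"
  let ?I = "B.paths T"
  have cell: "likelihood T p * measure B.Z (?E p) \<le> measure A.Z (?E p)" for p
  proof -
    have "(\<Prod>t<T. ratio (p t) (p (Suc t)) * pmf (B (p t)) (p (Suc t))) \<le>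
        (\<Prod>t<T. pmf (A (p t)) (p (Suc t)))"
      by (intro prod_mono) (auto simp: ratio_def)
    then show ?thesis
      by (auto simp: likelihood_def A.measure_cylinder B.measure_cylinder prod.distrib indicator_def)
  qed
  have "AE \<omega> in B.Z. ennreal (likelihood T \<omega>) = (\<Sum>p\<in>?I. ennreal (likelihood T p) * indicator (?E p) \<omega>)"
    using B.AE_confined
  proof eventually_elim
    case (elim \<omega>)
    let ?p = "restrict \<omega> {..T}"
    have "(\<Sum>p\<in>?I. ennreal (likelihood T p) * indicator (?E p) \<omega>) =
        (\<Sum>p\<in>?I. if p = ?p then ennreal (likelihood T p) else 0)"
    proof (intro sum.cong refl)
      fix p assume p: "p \<in> ?I"
      have "\<omega> \<in> ?E p \<longleftrightarrow> p = ?p"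
        using p by (auto simp: PiE_iff extensional_def fun_eq_iff)
      then show "ennreal (likelihood T p) * indicator (?E p) \<omega> =
          (if p = ?p then ennreal (likelihood T p) else 0)"
        by (simp add: indicator_def)
    qed
    also have "\<dots> = ennreal (likelihood T ?p)"
      using elim B.finite_paths by (simp add: PiE_iff)
    also have "likelihood T ?p = likelihood T \<omega>"
      unfolding likelihood_def by (intro prod.cong refl) auto
    finally show ?case by simp
  qed
  then have "(\<integral>\<^sup>+\<omega>. ennreal (likelihood T \<omega>) \<partial>B.Z) =
      (\<integral>\<^sup>+\<omega>. (\<Sum>p\<in>?I. ennreal (likelihood T p) * indicator (?E p) \<omega>) \<partial>B.Z)"
    by (rule nn_integral_cong_AE)
  also have "\<dots> = (\<Sum>p\<in>?I. ennreal (likelihood T p) * emeasure B.Z (?E p))"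
    using B.sets_cylinder
    by (subst nn_integral_sum) (auto simp: nn_integral_cmult_indicator)
  also have "\<dots> \<le> (\<Sum>p\<in>?I. ennreal (measure A.Z (?E p)))"
    using cell by (intro sum_mono)
      (simp add: B.Z.emeasure_eq_measure likelihood_def prod_nonneg ratio_nonneg flip: ennreal_mult)
  also have "\<dots> = ennreal (measure A.Z (\<Union>p\<in>?I. ?E p))"
    using A.sets_cylinder A.disjoint_cylinders[of T] A.finite_paths[of T]
    by (subst A.Z.finite_measure_finite_Union) auto
  also have "\<dots> \<le> 1" by (simp add: A.Z.prob_le_1)
  finally show ?thesis .
qed

text \<open>The chain rule for the divergence of the first \<open>T\<close> transitions, on the left, combined with the
  variational bound applied to the likelihood ratio of those transitions.\<close>
lemma finite_horizon_KL_le: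
  "ereal (\<Sum>t<T. \<Sum>s\<in>S. \<Sum>q\<in>S. A.occ t s * pmf (A s) q * ln (pmf (A s) q / pmf (B s) q))
     \<le> KL_div A.Z B.Z"
proof -
  let ?D = "\<Sum>t<T. \<Sum>s\<in>S. \<Sum>q\<in>S. A.occ t s * pmf (A s) q * ln (pmf (A s) q / pmf (B s) q)"
  have pos: "AE \<omega> in A.Z. \<forall>t. ratio (\<omega> t) (\<omega> (Suc t)) > 0"
    using A.AE_pair_positive A.AE_confined
  proof eventually_elim
    case (elim \<omega>)
    show ?case
    proof
      fix t
      have "A.occ t (\<omega> t) * pmf (A (\<omega> t)) (\<omega> (Suc t)) \<noteq> 0" using elim(1) by (metis less_irrefl)
      with support_subset[OF this] show "ratio (\<omega> t) (\<omega> (Suc t)) > 0"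
        using elim(2) by (auto simp: ratio_def less_le)
    qed
  qed
  have "has_bochner_integral A.Z (\<lambda>\<omega>. ln (ratio (\<omega> t) (\<omega> (Suc t))))
      (\<Sum>s\<in>S. \<Sum>q\<in>S. A.occ t s * pmf (A s) q * ln (ratio s q))" for t
    by (rule A.has_integral_pair) (auto simp: ratio_def)
  then have "has_bochner_integral A.Z (\<lambda>\<omega>. \<Sum>t<T. ln (ratio (\<omega> t) (\<omega> (Suc t))))
      (\<Sum>t<T. \<Sum>s\<in>S. \<Sum>q\<in>S. A.occ t s * pmf (A s) q * ln (ratio s q))"
    by (intro has_bochner_integral_sum)
  also have "(\<Sum>t<T. \<Sum>s\<in>S. \<Sum>q\<in>S. A.occ t s * pmf (A s) q * ln (ratio s q)) = ?D"
    by (intro sum.cong refl) (simp add: ratio_def)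
  finally have sum_int: "has_bochner_integral A.Z (\<lambda>\<omega>. \<Sum>t<T. ln (ratio (\<omega> t) (\<omega> (Suc t)))) ?D" .
  have meas: "likelihood T \<in> borel_measurable B.Z"
  proof -
    have "(\<lambda>\<omega>. ratio (\<omega> t) (\<omega> (Suc t))) \<in> borel_measurable B.Z" for t
      by (rule borel_measurable_has_bochner_integral[OF B.has_integral_pair]) (auto simp: ratio_def)
    then show ?thesis
      unfolding likelihood_def[abs_def] by (intro borel_measurable_prod)
  qed
  have sets: "sets A.Z = sets B.Z" by (simp only: sets_chain_measure)
  have ln_eq: "AE \<omega> in A.Z. ln (likelihood T \<omega>) = (\<Sum>t<T. ln (ratio (\<omega> t) (\<omega> (Suc t))))"
    using pos
  proof eventually_elim
    case (elim \<omega>)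
    then show ?case
      unfolding likelihood_def by (intro ln_prod, simp, metis less_irrefl)
  qed
  have meas_ln: "(\<lambda>\<omega>. ln (likelihood T \<omega>)) \<in> borel_measurable A.Z"
    using meas by (subst measurable_cong_sets[OF sets refl]) (rule borel_measurable_ln)
  have int: "has_bochner_integral A.Z (\<lambda>\<omega>. ln (likelihood T \<omega>)) ?D"
    using sum_int by (subst has_bochner_integral_cong_AE[OF meas_ln _ ln_eq])
      (rule borel_measurable_has_bochner_integral)
  have "ereal (\<integral>\<omega>. ln (likelihood T \<omega>) \<partial>A.Z) \<le> KL_div A.Z B.Z"
  proof (rule integral_ln_le_KL_div[OF A.prob_space_Z B.prob_space_Z sets meas _ likelihood_mass])
    show "AE \<omega> in A.Z. 0 < likelihood T \<omega>"
      using pos by eventually_elim (auto simp: likelihood_def intro!: prod_pos)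
  qed (use int in \<open>auto simp: likelihood_def prod_nonneg ratio_nonneg has_bochner_integral_iff\<close>)
  then show ?thesis
    using int by (simp add: has_bochner_integral_iff)
qed

end

section \<open>Expected visits to transient states\<close>

text \<open>The minimal solution \<open>b + b B + b B\<^sup>2 + \<dots>\<close> on \<open>D\<close> is the limit of its partial sums \<open>Y N\<close>, and only
  their boundedness is at stake. The mass that leaves \<open>D\<close> is at most the total mass of \<open>b\<close>, which bounds
  \<open>Y N s\<close> wherever \<open>D\<close> can be left in one step; and \<open>Y N s * B s z \<le> Y (Suc N) z\<close> carries a bound at
  \<open>z\<close> back to its predecessors. Walking an escape path backwards bounds \<open>Y\<close> everywhere on \<open>D\<close>.\<close>
lemma occupation_equation_solvable:
  fixes B :: "'s \<Rightarrow> 's \<Rightarrow> real" and b :: "'s \<Rightarrow> real"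
  assumes fin: "finite S" and DS: "D \<subseteq> S"
    and B_nonneg: "\<And>s q. 0 \<le> B s q" and B_sum: "\<And>s. s \<in> D \<Longrightarrow> (\<Sum>q\<in>S. B s q) = 1"
    and b_nonneg: "\<And>s. 0 \<le> b s"
    and escape: "\<And>s. s \<in> D \<Longrightarrow> \<exists>c. c \<notin> D \<and> (s, c) \<in> {(s, q). s \<in> S \<and> q \<in> S \<and> B s q > 0}\<^sup>*"
  obtains y where "\<And>s. s \<in> D \<Longrightarrow> 0 \<le> y s"
    and "\<And>s. s \<in> D \<Longrightarrow> y s = b s + (\<Sum>q\<in>D. y q * B q s)"
proof -
  let ?E = "{(s, q). s \<in> S \<and> q \<in> S \<and> B s q > 0}"
  have finD: "finite D" using fin DS by (rule finite_subset[rotated])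
  define Y where "Y = rec_nat (\<lambda>_. 0) (\<lambda>_ y s. b s + (\<Sum>q\<in>D. y q * B q s))"
  have Y_0: "Y 0 s = 0" and Y_Suc: "Y (Suc N) s = b s + (\<Sum>q\<in>D. Y N q * B q s)" for N s
    by (simp_all add: Y_def)
  have Y_nonneg: "0 \<le> Y N s" for N s
  proof (induction N arbitrary: s)
    case 0
    show ?case by (simp add: Y_0)
  next
    case (Suc N)
    show ?case
      unfolding Y_Suc by (intro add_nonneg_nonneg sum_nonneg mult_nonneg_nonneg b_nonneg B_nonneg Suc.IH)
  qed
  have Y_mono: "Y N s \<le> Y (Suc N) s" for N s
  proof (induction N arbitrary: s)
    case 0
    show ?case unfolding Y_0 by (rule Y_nonneg)
  next
    case (Suc N)
    show ?case
      unfolding Y_Suc[of "Suc N"] Y_Suc[of N s]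
      by (intro add_left_mono sum_mono mult_right_mono Suc.IH B_nonneg)
  qed
  have outflow: "(\<Sum>s\<in>D. Y N s * (\<Sum>q\<in>S - D. B s q)) \<le> (\<Sum>s\<in>D. b s)" for N
  proof -
    have split: "(\<Sum>q\<in>D. B s q) + (\<Sum>q\<in>S - D. B s q) = 1" if "s \<in> D" for s
      using B_sum[OF that] sum.subset_diff[OF DS fin, of "B s"] by linarith
    have "(\<Sum>s\<in>D. Y (Suc N) s) = (\<Sum>s\<in>D. b s) + (\<Sum>s\<in>D. \<Sum>q\<in>D. Y N q * B q s)"
      by (simp add: Y_Suc sum.distrib)
    also have "(\<Sum>s\<in>D. \<Sum>q\<in>D. Y N q * B q s) = (\<Sum>q\<in>D. Y N q * (\<Sum>s\<in>D. B q s))"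
      unfolding sum_distrib_left by (rule sum.swap)
    also have "\<dots> = (\<Sum>q\<in>D. Y N q - Y N q * (\<Sum>s\<in>S - D. B q s))"
    proof (intro sum.cong refl)
      fix q assume "q \<in> D"
      then have "(\<Sum>s\<in>D. B q s) = 1 - (\<Sum>s\<in>S - D. B q s)" using split[of q] by linarith
      then show "Y N q * (\<Sum>s\<in>D. B q s) = Y N q - Y N q * (\<Sum>s\<in>S - D. B q s)"
        by (simp only: right_diff_distrib mult_1_right)
    qed
    also have "\<dots> = (\<Sum>s\<in>D. Y N s) - (\<Sum>s\<in>D. Y N s * (\<Sum>q\<in>S - D. B s q))"
      by (simp add: sum_subtractf)
    finally show ?thesis
      using sum_mono[of D "Y N" "Y (Suc N)", OF Y_mono] by linarith
  qed
  have bounded: "\<exists>C. \<forall>N. Y N s \<le> C" if "(s, c) \<in> ?E\<^sup>*" "c \<notin> D" "s \<in> D" for s c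
    using that
  proof (induction rule: converse_rtrancl_induct)
    case base
    then show ?case by simp
  next
    case (step s z)
    then have pos: "B s z > 0" and zS: "z \<in> S" by auto
    show ?case
    proof (cases "z \<in> D")
      case False
      have "Y N s \<le> (\<Sum>s\<in>D. b s) / B s z" for N
      proof -
        have "Y N s * B s z \<le> Y N s * (\<Sum>q\<in>S - D. B s q)"
          using False zS fin by (intro mult_left_mono Y_nonneg member_le_sum B_nonneg) auto
        also have "\<dots> \<le> (\<Sum>s\<in>D. Y N s * (\<Sum>q\<in>S - D. B s q))"
          using finD step.prems
          by (intro member_le_sum[of s D "\<lambda>s. Y N s * (\<Sum>q\<in>S - D. B s q)"])
            (auto intro!: mult_nonneg_nonneg Y_nonneg sum_nonneg B_nonneg)
        also have "\<dots> \<le> (\<Sum>s\<in>D. b s)" by (rule outflow)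
        finally show ?thesis using pos by (simp add: field_simps)
      qed
      then show ?thesis by blast
    next
      case True
      with step obtain C where C: "\<And>N. Y N z \<le> C" by blast
      have "Y N s \<le> C / B s z" for N
      proof -
        have "Y N s * B s z \<le> (\<Sum>q\<in>D. Y N q * B q z)"
          using finD step.prems
          by (intro member_le_sum[of s D "\<lambda>q. Y N q * B q z"])
            (auto intro!: mult_nonneg_nonneg Y_nonneg B_nonneg)
        also have "\<dots> \<le> Y (Suc N) z" using b_nonneg[of z] by (simp add: Y_Suc)
        also have "\<dots> \<le> C" by (rule C)
        finally show ?thesis using pos by (simp add: field_simps)
      qed
      then show ?thesis by blast
    qed
  qed
  have "\<exists>L. (\<lambda>N. Y N s) \<longlonglongrightarrow> L" if s: "s \<in> D" for s
  proof -
    obtain C where "\<And>N. Y N s \<le> C" using escape[OF s] bounded[OF _ _ s] by blast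
    then show ?thesis
      using incseq_convergent[of "\<lambda>N. Y N s" C] Y_mono by (metis incseq_SucI)
  qed
  then obtain y where y: "\<And>s. s \<in> D \<Longrightarrow> (\<lambda>N. Y N s) \<longlonglongrightarrow> y s" by metis
  show thesis
  proof
    fix s assume s: "s \<in> D"
    show "0 \<le> y s"
      using y[OF s] by (rule LIMSEQ_le_const) (use Y_nonneg in blast)
    have "(\<lambda>N. Y (Suc N) s) \<longlonglongrightarrow> b s + (\<Sum>q\<in>D. y q * B q s)"
      unfolding Y_Suc by (intro tendsto_intros y)
    with LIMSEQ_Suc[OF y[OF s]] show "y s = b s + (\<Sum>q\<in>D. y q * B q s)"
      by (rule LIMSEQ_unique)
  qed
qed

text \<open>The log-sum inequality for \<open>(a, c)\<close> against \<open>(b, c)\<close>: flow that follows the reference policy adds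
  nothing to the divergence.\<close>
lemma mult_ln_ratio_add_common_le:
  fixes a b c :: real
  assumes "0 \<le> a" "0 \<le> b" "0 \<le> c" and "b = 0 \<Longrightarrow> a = 0"
  shows "(a + c) * ln ((a + c) / (b + c)) \<le> a * ln (a / b)"
proof (cases "a = 0")
  case True
  then show ?thesis
    using assms by (cases "c = 0") (auto intro!: mult_nonneg_nonpos)
next
  case False
  then have a: "a > 0" and b: "b > 0" using assms by (auto simp: less_le)
  \<comment> \<open>Using \<open>ln t \<le> t - 1\<close> at \<open>t = r * b / a\<close> and at \<open>t = r\<close>, the two linear terms add up to \<open>0\<close>.\<close>
  define r where "r = (a + c) / (b + c)"
  have r: "r > 0" using a b assms by (simp add: r_def)
  have "a * ln (r * b / a) \<le> a * (r * b / a - 1)"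
    using a b r by (intro mult_left_mono ln_le_minus_one) auto
  also have "\<dots> = r * b - a" using a by (simp add: right_diff_distrib)
  also have "ln (r * b / a) = ln r - ln (a / b)"
    using a b r by (simp add: ln_mult ln_div)
  finally have "a * (ln r - ln (a / b)) \<le> r * b - a" .
  moreover have "c * ln r \<le> c * (r - 1)"
    using r assms by (intro mult_left_mono ln_le_minus_one) auto
  moreover have "r * (b + c) = a + c" using b assms by (simp add: r_def)
  ultimately have "a * (ln r - ln (a / b)) + c * ln r \<le> 0"
    by (simp add: algebra_simps)
  then show ?thesis by (simp add: r_def algebra_simps)
qed

section \<open>Flows of a single agent\<close>

lemma policy_trans_nonneg: "0 \<le> policy_trans M \<pi> s q"
  by (simp add: policy_trans_def sum_nonneg)

locale reach_mdp =
  fixes M :: "('s, 'a) mdp" and \<pi>S :: "'s \<Rightarrow> 'a pmf" and R :: "'s set"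
  assumes M: "finite_mdp M" and \<pi>S: "\<pi>S \<in> policies M"
    and R: "R \<subseteq> states M" and R_absorbing: "\<And>s. s \<in> R \<Longrightarrow> absorbing M s"
begin

abbreviation E where "E \<equiv> chain_edges M \<pi>S"
abbreviation D where "D \<equiv> decision_states M \<pi>S R"
abbreviation C where "C \<equiv> closed_class_states M \<pi>S"

lemma finite_states: "finite (states M)"
  using M by (simp add: finite_mdp_def)

lemma finite_avail: "s \<in> states M \<Longrightarrow> finite (avail M s)"
  using M by (meson finite_mdp_def finite_subset)

lemma D_subset: "D \<subseteq> states M"
  by (auto simp: decision_states_def)

lemma finite_D: "finite D"
  using finite_states D_subset by (rule finite_subset[rotated])

lemma Succ_subset: "Succ M s \<subseteq> states M"
  by (auto simp: Succ_def)

lemma policy_trans_zero: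
  assumes "s \<in> states M" "q \<notin> Succ M s"
  shows "policy_trans M \<pi> s q = 0"
proof -
  have "pmf (trans M s a) q = 0" if a: "a \<in> avail M s" for a
  proof (cases "q \<in> states M")
    case True
    with assms a show ?thesis by (auto simp: Succ_def less_le)
  next
    case False
    with M assms(1) a show ?thesis by (auto simp: finite_mdp_def pmf_eq_0_set_pmf)
  qed
  then show ?thesis by (simp add: policy_trans_def)
qed

lemma finite_chain_policy:
  assumes "\<pi> \<in> policies M"
  shows "finite_chain (policy_kernel M \<pi>) (init M) (states M)"
proof
  show "finite (states M)" "init M \<in> states M"
    using M by (auto simp: finite_mdp_def)
  show "set_pmf (policy_kernel M \<pi> s) \<subseteq> states M" if "s \<in> states M" for s
    using that M assms by (fastforce simp: policy_kernel_def finite_mdp_def policies_def)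
qed

lemma sum_policy_trans:
  assumes "\<pi> \<in> policies M" "s \<in> states M"
  shows "(\<Sum>q\<in>states M. policy_trans M \<pi> s q) = 1"
  using finite_chain.sum_K[OF finite_chain_policy[OF assms(1)] assms(2)]
  by (simp add: pmf_policy_kernel[OF M assms])

lemma reach_in_states: "(s, q) \<in> E\<^sup>* \<Longrightarrow> s \<in> states M \<Longrightarrow> q \<in> states M"
  by (induction rule: rtrancl_induct) (auto simp: chain_edges_def)

text \<open>Among the states reachable from \<open>s\<close>, one with the fewest reachable states can be reached back from
  everything it reaches, so its communicating class is closed.\<close>
lemma reaches_closed_class:
  assumes s: "s \<in> states M"
  shows "\<exists>c\<in>C. (s, c) \<in> E\<^sup>*"
proof -
  let ?reach = "\<lambda>q. {r. (q, r) \<in> E\<^sup>*}"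
  obtain q where q: "(s, q) \<in> E\<^sup>*" and min: "\<And>r. (s, r) \<in> E\<^sup>* \<Longrightarrow> card (?reach q) \<le> card (?reach r)"
    using ex_has_least_nat[of "\<lambda>q. (s, q) \<in> E\<^sup>*" s "\<lambda>q. card (?reach q)"] by auto
  have qs: "q \<in> states M" using q s by (rule reach_in_states)
  have fin: "finite (?reach q)"
    by (rule finite_subset[OF _ finite_states]) (use qs reach_in_states in blast)
  have return: "(r, q) \<in> E\<^sup>*" if qr: "(q, r) \<in> E\<^sup>*" for r
  proof -
    have sub: "?reach r \<subseteq> ?reach q" using qr by auto
    have "card (?reach q) \<le> card (?reach r)" using q qr by (intro min) auto
    then have "?reach r = ?reach q"
      using card_seteq[OF fin sub] by simp
    then show ?thesis by auto
  qed
  let ?K = "communicating M \<pi>S `` {q}"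
  have "?K \<in> states M // communicating M \<pi>S" using qs by (rule quotientI)
  moreover have "E `` ?K \<subseteq> ?K"
  proof
    fix r' assume "r' \<in> E `` ?K"
    then obtain r where r: "(q, r) \<in> E\<^sup>*" "(r, r') \<in> E" by (auto simp: communicating_def)
    then have "(q, r') \<in> E\<^sup>*" by simp
    then show "r' \<in> ?K"
      using qs return reach_in_states by (auto simp: communicating_def)
  qed
  moreover have "q \<in> ?K" using qs by (auto simp: communicating_def)
  ultimately have "q \<in> C" unfolding closed_class_states_def by blast
  with q show ?thesis by blast
qed

lemma closed_class_edge: "s \<in> C \<Longrightarrow> (s, q) \<in> E \<Longrightarrow> q \<in> C \<and> (q, s) \<in> E\<^sup>*"
  unfolding closed_class_states_def quotient_def communicating_def
  by (auto intro: rtrancl_trans)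

lemma absorbing_edge: "s \<in> R \<Longrightarrow> (s, q) \<in> E \<Longrightarrow> q = s"
  using policy_trans_zero[of s q \<pi>S] R_absorbing[of s]
  by (auto simp: chain_edges_def absorbing_def)

lemma absorbing_reach: "(s, q) \<in> E\<^sup>* \<Longrightarrow> s \<in> R \<Longrightarrow> q = s"
  by (induction rule: rtrancl_induct) (auto dest: absorbing_edge)

lemma R_subset_C: "R \<subseteq> C"
  using reaches_closed_class absorbing_reach R by blast

lemma decision_states_eq: "D = states M - C"
  using R_subset_C by (auto simp: decision_states_def)

lemma sum_flow:
  assumes "s \<in> states M"
  shows "(\<Sum>q\<in>states M. flow M x s q) = (\<Sum>a\<in>avail M s. x s a)"
proof -
  have "(\<Sum>q\<in>states M. flow M x s q) = (\<Sum>a\<in>avail M s. x s a * (\<Sum>q\<in>states M. pmf (trans M s a) q))"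
    unfolding flow_def by (subst sum.swap) (simp add: sum_distrib_left)
  also have "\<dots> = (\<Sum>a\<in>avail M s. x s a)"
  proof (intro sum.cong refl)
    fix a assume "a \<in> avail M s"
    then have "(\<Sum>q\<in>states M. pmf (trans M s a) q) = 1"
      using M assms by (intro sum_pmf_eq_1) (auto simp: finite_mdp_def)
    then show "x s a * (\<Sum>q\<in>states M. pmf (trans M s a) q) = x s a" by simp
  qed
  finally show ?thesis .
qed

text \<open>Summing the balance equations over the decision states leaves the flow out of them equal to the
  initial mass that starts inside; the target states receive at most that flow.\<close>
lemma flow_reach_le_1:
  assumes x: "x \<in> feasible_flows M \<pi>S R K"
  shows "flow_reach M \<pi>S R x \<le> 1"
proof -
  have nonneg: "0 \<le> flow M x s q" if "s \<in> D" for s q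
    using x that by (auto simp: feasible_flows_def flow_def intro!: sum_nonneg)
  have "(\<Sum>s\<in>D. \<Sum>a\<in>avail M s. x s a) = (\<Sum>s\<in>D. (\<Sum>q\<in>D. flow M x q s) + indicator {init M} s)"
    using x by (intro sum.cong refl) (auto simp: feasible_flows_def flow_balance_def)
  also have "\<dots> = (\<Sum>q\<in>D. \<Sum>s\<in>D. flow M x q s) + (\<Sum>s\<in>D. indicator {init M} s)"
    unfolding sum.distrib by (subst sum.swap) simp
  finally have bal: "(\<Sum>s\<in>D. \<Sum>a\<in>avail M s. x s a) =
      (\<Sum>q\<in>D. \<Sum>s\<in>D. flow M x q s) + (\<Sum>s\<in>D. indicator {init M} s)" .
  have disj: "R \<inter> D = {}" and finR: "finite R"
    using R finite_states finite_subset by (auto simp: decision_states_def)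
  have "(\<Sum>s\<in>D. \<Sum>q\<in>R. flow M x s q) + (\<Sum>s\<in>D. \<Sum>q\<in>D. flow M x s q) =
      (\<Sum>s\<in>D. \<Sum>q\<in>R \<union> D. flow M x s q)"
    using disj finR finite_D by (simp add: sum.union_disjoint sum.distrib)
  also have "\<dots> \<le> (\<Sum>s\<in>D. \<Sum>q\<in>states M. flow M x s q)"
    using R D_subset nonneg by (intro sum_mono sum_mono2 finite_states) auto
  also have "\<dots> = (\<Sum>s\<in>D. \<Sum>a\<in>avail M s. x s a)"
    using D_subset by (intro sum.cong refl sum_flow) auto
  finally have "(\<Sum>s\<in>D. \<Sum>q\<in>R. flow M x s q) \<le> (\<Sum>s\<in>D. indicator {init M} s)"
    using bal by simp
  moreover have "flow_reach M \<pi>S R x = (\<Sum>q\<in>R. indicator {init M} q) + (\<Sum>s\<in>D. \<Sum>q\<in>R. flow M x s q)"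
    unfolding flow_reach_def sum.distrib by (subst (2) sum.swap) simp
  moreover have "(\<Sum>q\<in>R. indicator {init M} q :: real) + (\<Sum>s\<in>D. indicator {init M} s) \<le> 1"
    using disj finR finite_D by (auto simp: indicator_def of_bool_def sum.delta)
  ultimately show ?thesis by simp
qed

lemma flow_reach_le_Reach:
  "x \<in> feasible_flows M \<pi>S R K \<Longrightarrow> flow_reach M \<pi>S R x \<le> Reach M \<pi>S R K"
  unfolding Reach_def by (intro cSUP_upper bdd_aboveI2[where M = 1] flow_reach_le_1)

text \<open>The occupation variables of an agent who spends \<open>v s\<close> visits to \<open>s\<close> following \<open>\<pi>\<close> and \<open>y s\<close> further
  visits following the reference policy.\<close>
definition switched_flow ::
  "('s \<Rightarrow> 'a pmf) \<Rightarrow> ('s \<Rightarrow> real) \<Rightarrow> ('s \<Rightarrow> real) \<Rightarrow> 's \<Rightarrow> 'a \<Rightarrow> real" where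
  "switched_flow \<pi> v y s a = v s * pmf (\<pi> s) a + y s * pmf (\<pi>S s) a"

lemma flow_switched_flow:
  "flow M (switched_flow \<pi> v y) s q = v s * policy_trans M \<pi> s q + y s * policy_trans M \<pi>S s q"
  by (simp add: flow_def switched_flow_def policy_trans_def sum.distrib sum_distrib_left algebra_simps)

lemma sum_switched_flow:
  assumes "\<pi> \<in> policies M" "s \<in> states M"
  shows "(\<Sum>a\<in>avail M s. switched_flow \<pi> v y s a) = v s + y s"
  using assms \<pi>S finite_avail[OF assms(2)]
  by (simp add: switched_flow_def sum.distrib sum_distrib_left[symmetric] sum_pmf_eq_1 policies_def)

text \<open>Only the visits made under \<open>\<pi>\<close> cost divergence. The bound on the right includes the states outside
  the decision states as well, where each row contributes a nonnegative relative entropy; this is the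
  form that matches the divergence of the paths.\<close>
lemma KL_flow_switched_flow_le:
  assumes \<pi>: "\<pi> \<in> policies M" and v: "\<And>s. 0 \<le> v s" and y: "\<And>s. s \<in> D \<Longrightarrow> 0 \<le> y s"
    and supp: "\<And>s q. s \<in> states M \<Longrightarrow> v s * policy_trans M \<pi> s q \<noteq> 0 \<Longrightarrow>
      policy_trans M \<pi>S s q \<noteq> 0"
  shows "KL_flow M \<pi>S R (switched_flow \<pi> v y) \<le>
    ereal (\<Sum>s\<in>states M. \<Sum>q\<in>states M.
      v s * policy_trans M \<pi> s q * ln (policy_trans M \<pi> s q / policy_trans M \<pi>S s q))"
proof -
  let ?A = "policy_trans M \<pi>" and ?B = "policy_trans M \<pi>S" and ?x = "switched_flow \<pi> v y"
  have term_le: "flow M ?x s q * ln (flow M ?x s q / (?B s q * (\<Sum>a\<in>avail M s. ?x s a))) \<le>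
      v s * ?A s q * ln (?A s q / ?B s q)" if s: "s \<in> D" for s q
  proof -
    have "(v s * ?A s q + y s * ?B s q) * ln ((v s * ?A s q + y s * ?B s q) / (v s * ?B s q + y s * ?B s q))
        \<le> v s * ?A s q * ln (v s * ?A s q / (v s * ?B s q))"
      using v[of s] y[OF s] supp[of s q] D_subset s
      by (intro mult_ln_ratio_add_common_le) (auto intro!: mult_nonneg_nonneg policy_trans_nonneg)
    also have "\<dots> = v s * ?A s q * ln (?A s q / ?B s q)" by simp
    finally show ?thesis
      using D_subset s by (simp add: flow_switched_flow sum_switched_flow[OF \<pi>] subset_iff algebra_simps)
  qed
  have row_nonneg: "0 \<le> (\<Sum>q\<in>states M. v s * ?A s q * ln (?A s q / ?B s q))" if s: "s \<in> states M" for s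
  proof -
    have "v s * (?A s q - ?B s q) \<le> v s * ?A s q * ln (?A s q / ?B s q)" for q
    proof (cases "v s * ?A s q = 0")
      case True
      then show ?thesis using v[of s] policy_trans_nonneg[of M \<pi>S s q] by auto
    next
      case False
      then have pos: "?A s q > 0" "?B s q > 0"
        using supp[OF s False] policy_trans_nonneg[of M] by (auto simp: less_le)
      have "ln (?B s q / ?A s q) \<le> ?B s q / ?A s q - 1"
        using pos by (intro ln_le_minus_one) auto
      then have "?A s q * (1 - ?B s q / ?A s q) \<le> ?A s q * ln (?A s q / ?B s q)"
        using pos by (intro mult_left_mono) (auto simp: ln_div)
      then have "?A s q - ?B s q \<le> ?A s q * ln (?A s q / ?B s q)"
        using pos by (simp add: right_diff_distrib)
      then show ?thesis
        using v[of s] by (simp add: mult.assoc mult_left_mono)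
    qed
    then have "(\<Sum>q\<in>states M. v s * (?A s q - ?B s q)) \<le> (\<Sum>q\<in>states M. v s * ?A s q * ln (?A s q / ?B s q))"
      by (rule sum_mono)
    moreover have "(\<Sum>q\<in>states M. v s * (?A s q - ?B s q)) = 0"
      using sum_policy_trans[OF \<pi> s] sum_policy_trans[OF \<pi>S s]
      by (simp add: sum_distrib_left[symmetric] sum_subtractf)
    ultimately show ?thesis by simp
  qed
  have flow_zero: "flow M ?x s q = 0" if "s \<in> D" "q \<notin> Succ M s" for s q
    using that D_subset by (auto simp: flow_switched_flow policy_trans_zero)
  have "KL_flow M \<pi>S R ?x = (\<Sum>s\<in>D. \<Sum>q\<in>Succ M s.
      ereal (flow M ?x s q * ln (flow M ?x s q / (?B s q * (\<Sum>a\<in>avail M s. ?x s a)))))"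
    unfolding KL_flow_def
  proof (intro sum.cong refl)
    fix s q assume "s \<in> D"
    then have "flow M ?x s q = 0" if "?B s q = 0"
      using supp[of s q] that D_subset by (auto simp: flow_switched_flow)
    then show "(if flow M ?x s q = 0 then 0 else if ?B s q = 0 then \<infinity>
          else ereal (flow M ?x s q * ln (flow M ?x s q / (?B s q * (\<Sum>a\<in>avail M s. ?x s a))))) =
        ereal (flow M ?x s q * ln (flow M ?x s q / (?B s q * (\<Sum>a\<in>avail M s. ?x s a))))"
      by auto
  qed
  then have KL_eq: "KL_flow M \<pi>S R ?x = ereal (\<Sum>s\<in>D. \<Sum>q\<in>Succ M s.
      flow M ?x s q * ln (flow M ?x s q / (?B s q * (\<Sum>a\<in>avail M s. ?x s a))))"
    by simp
  have "(\<Sum>s\<in>D. \<Sum>q\<in>Succ M s.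
      flow M ?x s q * ln (flow M ?x s q / (?B s q * (\<Sum>a\<in>avail M s. ?x s a)))) =
    (\<Sum>s\<in>D. \<Sum>q\<in>states M.
      flow M ?x s q * ln (flow M ?x s q / (?B s q * (\<Sum>a\<in>avail M s. ?x s a))))"
    by (intro sum.cong refl sum.mono_neutral_left finite_states Succ_subset) (auto simp: flow_zero)
  also have "\<dots> \<le> (\<Sum>s\<in>D. \<Sum>q\<in>states M. v s * ?A s q * ln (?A s q / ?B s q))"
    by (intro sum_mono term_le)
  also have "\<dots> \<le> (\<Sum>s\<in>states M. \<Sum>q\<in>states M. v s * ?A s q * ln (?A s q / ?B s q))"
    by (rule sum_mono2[OF finite_states D_subset]) (use row_nonneg in blast)
  finally show ?thesis unfolding KL_eq ereal_less_eq .
qed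

end

section \<open>Reachability under small divergence\<close>

locale dominated_policy = reach_mdp M \<pi>S R
  for M :: "('s, 'a) mdp" and \<pi>S :: "'s \<Rightarrow> 'a pmf" and R :: "'s set" +
  fixes \<pi>A :: "'s \<Rightarrow> 'a pmf"
  assumes \<pi>A: "\<pi>A \<in> policies M"
    and ac_path: "absolutely_continuous (path_measure M \<pi>S) (path_measure M \<pi>A)"
begin

sublocale finite_chain_pair "policy_kernel M \<pi>A" "policy_kernel M \<pi>S" "init M" "states M"
proof (intro finite_chain_pair.intro finite_chain_pair_axioms.intro finite_chain_policy)
  show "absolutely_continuous (chain_measure (policy_kernel M \<pi>S) (init M))
     (chain_measure (policy_kernel M \<pi>A) (init M))"
    using ac_path by (simp only: path_measure_def)
qed (rule \<pi>A \<pi>S)+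

abbreviation tA where "tA \<equiv> policy_trans M \<pi>A"
abbreviation tS where "tS \<equiv> policy_trans M \<pi>S"

lemma kernel_eq:
  assumes "s \<in> states M"
  shows "pmf (policy_kernel M \<pi>A s) q = tA s q" "pmf (policy_kernel M \<pi>S s) q = tS s q"
  using assms by (auto intro: pmf_policy_kernel M \<pi>A \<pi>S)

lemma edge_if_used:
  assumes "A.occ t s * tA s q \<noteq> 0" "s \<in> states M"
  shows "(s, q) \<in> E"
proof -
  have "tS s q \<noteq> 0"
    using support_subset[of t s q] assms by (simp add: kernel_eq)
  moreover have "q \<in> states M"
    using assms policy_trans_zero[of s q \<pi>A] Succ_subset[of s] by (metis mult_zero_right subsetD)
  ultimately show ?thesis
    using assms policy_trans_nonneg[of M \<pi>S s q] by (auto simp: chain_edges_def less_le)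
qed

definition visits :: "nat \<Rightarrow> 's \<Rightarrow> real" where
  "visits T s = (\<Sum>t<T. A.occ t s)"

lemma visits_nonneg: "0 \<le> visits T s"
  by (simp add: visits_def sum_nonneg A.occ_nonneg)

text \<open>No probability enters the decision states from outside: the complement is closed under the
  transitions of the reference policy, and \<open>\<pi>A\<close> only uses those. The mass \<open>A.occ T\<close> still in the
  decision states at time \<open>T\<close> is exactly what violates the balance equations.\<close>
lemma visits_balance:
  assumes s: "s \<in> D"
  shows "(\<Sum>q\<in>D. visits T q * tA q s) = visits T s + A.occ T s - indicator {init M} s"
proof -
  have step: "(\<Sum>q\<in>D. A.occ t q * tA q s) = A.occ (Suc t) s" for t
  proof -
    have "A.occ (Suc t) s = (\<Sum>q\<in>states M. A.occ t q * tA q s)"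
      by (simp add: A.occ_Suc kernel_eq)
    also have "\<dots> = (\<Sum>q\<in>D. A.occ t q * tA q s)"
    proof (rule sum.mono_neutral_right[OF finite_states D_subset], rule ballI)
      fix q assume q: "q \<in> states M - D"
      show "A.occ t q * tA q s = 0"
      proof (rule ccontr)
        assume "A.occ t q * tA q s \<noteq> 0"
        then have "(q, s) \<in> E" using edge_if_used q by blast
        then show False
          using q s closed_class_edge[of q s] by (auto simp: decision_states_eq)
      qed
    qed
    finally show ?thesis by simp
  qed
  have "(\<Sum>q\<in>D. visits T q * tA q s) = (\<Sum>t<T. \<Sum>q\<in>D. A.occ t q * tA q s)"
    unfolding visits_def sum_distrib_right by (rule sum.swap)
  also have "\<dots> = (\<Sum>t<T. A.occ (Suc t) s)" by (simp add: step)
  also have "\<dots> = visits T s + A.occ T s - A.occ 0 s"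
    using sum.lessThan_Suc_shift[of "\<lambda>t. A.occ t s" T] by (simp add: visits_def)
  finally show ?thesis by (simp add: A.occ_0)
qed

text \<open>An absorbing target state is entered from decision states only: a closed class that contains it
  contains nothing else.\<close>
lemma occ_target:
  assumes q: "q \<in> R"
  shows "A.occ T q = indicator {init M} q + (\<Sum>s\<in>D. visits T s * tA s q)"
proof (induction T)
  case 0
  then show ?case by (simp add: A.occ_0 visits_def)
next
  case (Suc T)
  have qs: "q \<in> states M" and qD: "q \<notin> D" using q R by (auto simp: decision_states_def)
  have stay: "tA q q = 1"
  proof -
    have "1 = (\<Sum>r\<in>states M. tA q r)" using sum_policy_trans[OF \<pi>A qs] by simp
    also have "\<dots> = (\<Sum>r\<in>{q}. tA q r)"
      using qs R_absorbing[OF q]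
      by (intro sum.mono_neutral_right finite_states) (auto simp: policy_trans_zero absorbing_def)
    finally show ?thesis by simp
  qed
  have "A.occ (Suc T) q = (\<Sum>s\<in>states M. A.occ T s * tA s q)"
    by (simp add: A.occ_Suc kernel_eq)
  also have "\<dots> = (\<Sum>s\<in>insert q D. A.occ T s * tA s q)"
  proof (rule sum.mono_neutral_right[OF finite_states], use qs D_subset in blast, rule ballI)
    fix s assume s: "s \<in> states M - insert q D"
    show "A.occ T s * tA s q = 0"
    proof (rule ccontr)
      assume "A.occ T s * tA s q \<noteq> 0"
      then have "(s, q) \<in> E" using edge_if_used s by blast
      then have "(q, s) \<in> E\<^sup>*" using s closed_class_edge[of s q] by (auto simp: decision_states_eq)
      then show False using absorbing_reach[of q s] q s by auto
    qed
  qed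
  also have "\<dots> = A.occ T q + (\<Sum>s\<in>D. A.occ T s * tA s q)"
    using qD finite_D stay by simp
  also have "\<dots> = indicator {init M} q + ((\<Sum>s\<in>D. visits T s * tA s q) + (\<Sum>s\<in>D. A.occ T s * tA s q))"
    unfolding Suc.IH by (rule add.assoc)
  also have "(\<Sum>s\<in>D. visits T s * tA s q) + (\<Sum>s\<in>D. A.occ T s * tA s q) =
      (\<Sum>s\<in>D. visits (Suc T) s * tA s q)"
    by (simp add: visits_def distrib_right flip: sum.distrib)
  finally show ?case .
qed

text \<open>Follow \<open>\<pi>A\<close> for \<open>T\<close> steps and the reference policy afterwards. The expected visits to decision states
  after time \<open>T\<close> solve the occupation equation with source \<open>A.occ T\<close>, which is solvable because the
  reference policy leaves the decision states; this repairs the balance without changing the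
  divergence.\<close>
lemma feasible_flow_attaining_occ:
  assumes KL: "KL_div (path_measure M \<pi>A) (path_measure M \<pi>S) \<le> ereal K"
  shows "\<exists>x\<in>feasible_flows M \<pi>S R K. (\<Sum>q\<in>R. A.occ T q) \<le> flow_reach M \<pi>S R x"
proof -
  obtain y where y_nonneg: "\<And>s. s \<in> D \<Longrightarrow> 0 \<le> y s"
    and y: "\<And>s. s \<in> D \<Longrightarrow> y s = A.occ T s + (\<Sum>q\<in>D. y q * tS q s)"
  proof (rule occupation_equation_solvable[OF finite_states D_subset, of tS "A.occ T"])
    show "\<exists>c. c \<notin> D \<and> (s, c) \<in> {(s, q). s \<in> states M \<and> q \<in> states M \<and> 0 < tS s q}\<^sup>*" if "s \<in> D" for s
      using reaches_closed_class[of s] that D_subset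
      by (fastforce simp: decision_states_eq chain_edges_def)
  qed (use D_subset in \<open>auto simp: policy_trans_nonneg A.occ_nonneg sum_policy_trans[OF \<pi>S]\<close>)
  let ?x = "switched_flow \<pi>A (visits T) y"
  have v_nonneg: "0 \<le> visits T s" for s by (rule visits_nonneg)
  have supp: "tS s q \<noteq> 0" if "s \<in> states M" "visits T s * tA s q \<noteq> 0" for s q
  proof -
    have "\<exists>t<T. A.occ t s * tA s q \<noteq> 0"
      using that(2) unfolding visits_def sum_distrib_right by (metis (no_types, lifting) lessThan_iff sum.neutral)
    then show ?thesis using edge_if_used[of _ s q] that(1) by (auto simp: chain_edges_def)
  qed
  have "KL_flow M \<pi>S R ?x \<le>
      ereal (\<Sum>s\<in>states M. \<Sum>q\<in>states M. visits T s * tA s q * ln (tA s q / tS s q))"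
    by (rule KL_flow_switched_flow_le[OF \<pi>A v_nonneg y_nonneg supp])
  also have "(\<Sum>s\<in>states M. \<Sum>q\<in>states M. visits T s * tA s q * ln (tA s q / tS s q)) =
      (\<Sum>s\<in>states M. \<Sum>t<T. \<Sum>q\<in>states M. A.occ t s * tA s q * ln (tA s q / tS s q))"
    unfolding visits_def sum_distrib_right by (intro sum.cong refl sum.swap)
  also have "\<dots> = (\<Sum>t<T. \<Sum>s\<in>states M. \<Sum>q\<in>states M. A.occ t s * tA s q * ln (tA s q / tS s q))"
    by (rule sum.swap)
  also have "\<dots> = (\<Sum>t<T. \<Sum>s\<in>states M. \<Sum>q\<in>states M. A.occ t s * pmf (policy_kernel M \<pi>A s) q *
        ln (pmf (policy_kernel M \<pi>A s) q / pmf (policy_kernel M \<pi>S s) q))"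
    by (intro sum.cong refl) (simp add: kernel_eq)
  also have "ereal \<dots> \<le> KL_div (path_measure M \<pi>A) (path_measure M \<pi>S)"
    unfolding path_measure_def by (rule finite_horizon_KL_le)
  also note KL
  finally have KL_x: "KL_flow M \<pi>S R ?x \<le> ereal K" .
  have "flow_balance M \<pi>S R ?x s = 0" if s: "s \<in> D" for s
    using visits_balance[OF s, of T] y[OF s] s D_subset
    by (simp add: flow_balance_def flow_switched_flow sum_switched_flow[OF \<pi>A] subset_iff sum.distrib)
  moreover have "0 \<le> ?x s a" if "s \<in> D" for s a
    using v_nonneg y_nonneg[OF that] by (simp add: switched_flow_def)
  ultimately have "?x \<in> feasible_flows M \<pi>S R K"
    using KL_x by (simp add: feasible_flows_def)
  moreover have "(\<Sum>q\<in>R. A.occ T q) \<le> flow_reach M \<pi>S R ?x"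
    unfolding flow_reach_def flow_switched_flow
    by (intro sum_mono, subst occ_target)
      (auto intro!: sum_mono mult_nonneg_nonneg y_nonneg policy_trans_nonneg)
  ultimately show ?thesis by blast
qed

lemma reach_prob_le_Reach:
  assumes KL: "KL_div (path_measure M \<pi>A) (path_measure M \<pi>S) \<le> ereal K"
  shows "reach_prob M \<pi>A R \<le> Reach M \<pi>S R K"
proof -
  let ?H = "\<lambda>T :: nat. {\<omega>. \<exists>t\<le>T. \<omega> t \<in> R}"
  have finR: "finite R" using R finite_states by (rule finite_subset)
  have at: "{\<omega>. \<omega> T \<in> R} = (\<Union>q\<in>R. {\<omega>. \<omega> T = q})" for T :: nat by auto
  have at_sets: "{\<omega>. \<omega> T \<in> R} \<in> sets A.Z" for T
    unfolding at by (intro sets.finite_UN finR A.sets_coord)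
  have H_sets: "?H T \<in> sets A.Z" for T
  proof -
    have "?H T = (\<Union>t\<in>{..T}. {\<omega>. \<omega> t \<in> R})" by auto
    also have "\<dots> \<in> sets A.Z" by (intro sets.finite_UN finite_atMost at_sets)
    finally show ?thesis .
  qed
  \<comment> \<open>Targets are absorbing, so having hit one by time \<open>T\<close> means sitting in one at time \<open>T\<close>.\<close>
  have "AE \<omega> in A.Z. \<omega> \<in> ?H T \<longleftrightarrow> \<omega> \<in> {\<omega>. \<omega> T \<in> R}" for T
    using A.AE_pair_positive
  proof eventually_elim
    case (elim \<omega>)
    have step: "\<omega> (Suc t) \<in> R" if t: "\<omega> t \<in> R" for t
    proof -
      have ws: "\<omega> t \<in> states M" using t R by auto
      have "tA (\<omega> t) (\<omega> (Suc t)) \<noteq> 0"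
        using spec[OF elim, of t] kernel_eq(1)[OF ws, of "\<omega> (Suc t)"] by auto
      then have "\<omega> (Suc t) \<in> Succ M (\<omega> t)" using policy_trans_zero[OF ws] by blast
      then show ?thesis using R_absorbing[OF t] t by (simp add: absorbing_def)
    qed
    have "\<omega> T \<in> R" if "t \<le> T" "\<omega> t \<in> R" for t
      using that by (induction rule: dec_induct) (auto intro: step)
    then show ?case by auto
  qed
  then have "measure A.Z (?H T) = measure A.Z {\<omega>. \<omega> T \<in> R}" for T
    by (rule A.Z.finite_measure_eq_AE[OF _ H_sets at_sets])
  moreover have "measure A.Z {\<omega>. \<omega> T \<in> R} = (\<Sum>q\<in>R. A.occ T q)" for T
    unfolding at A.occ_def
  proof (rule A.Z.finite_measure_finite_Union[OF finR])
    show "(\<lambda>q. {\<omega>. \<omega> T = q}) ` R \<subseteq> sets A.Z" using A.sets_coord by blast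
  qed (auto simp: disjoint_family_on_def)
  ultimately have at_eq: "measure A.Z (?H T) = (\<Sum>q\<in>R. A.occ T q)" for T
    by (rule trans)
  have le: "measure A.Z (?H T) \<le> Reach M \<pi>S R K" for T
  proof -
    obtain x where "x \<in> feasible_flows M \<pi>S R K" "(\<Sum>q\<in>R. A.occ T q) \<le> flow_reach M \<pi>S R x"
      using feasible_flow_attaining_occ[OF KL, of T] by (rule bexE)
    then show ?thesis unfolding at_eq using flow_reach_le_Reach[of x K] by linarith
  qed
  have "range ?H \<subseteq> sets A.Z" using H_sets by blast
  moreover have "incseq ?H"
  proof (rule incseq_SucI)
    show "?H T \<subseteq> ?H (Suc T)" for T by (auto intro: le_SucI)
  qed
  ultimately have lim: "(\<lambda>T. measure A.Z (?H T)) \<longlonglongrightarrow> measure A.Z (\<Union>T. ?H T)"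
    by (rule A.Z.finite_Lim_measure_incseq)
  have "(\<Union>T. ?H T) = {\<omega>. \<exists>t. \<omega> t \<in> R}"
  proof (intro equalityI subsetI)
    fix \<omega> :: "nat \<Rightarrow> 's"
    assume "\<omega> \<in> {\<omega>. \<exists>t. \<omega> t \<in> R}"
    then obtain t where "\<omega> t \<in> R" by auto
    then have "\<omega> \<in> ?H t" by auto
    then show "\<omega> \<in> (\<Union>T. ?H T)" by (rule UN_I[OF UNIV_I])
  qed auto
  then have "reach_prob M \<pi>A R = measure A.Z (\<Union>T. ?H T)"
    by (simp only: reach_prob_def path_measure_def)
  also have "\<dots> \<le> Reach M \<pi>S R K"
    by (rule LIMSEQ_le_const2[OF lim]) (intro exI allI impI le)
  finally show ?thesis .
qed

end

text \<open>The bound by \<open>1\<close> makes the factors \<open>1 - Reach\<close> of the team objective nonnegative, so that their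
  product is monotone. It concerns a supremum, so it is stated where a policy of small divergence
  provides a feasible flow.\<close>
lemma (in reach_mdp) reach_prob_le_Reach_le_1:
  assumes "\<pi>A \<in> policies M"
    and KL: "KL_div (path_measure M \<pi>A) (path_measure M \<pi>S) \<le> ereal K"
  shows "reach_prob M \<pi>A R \<le> Reach M \<pi>S R K \<and> Reach M \<pi>S R K \<le> 1"
proof -
  have "absolutely_continuous (path_measure M \<pi>S) (path_measure M \<pi>A)"
    using KL by (auto simp: KL_div_def split: if_splits)
  then interpret dominated_policy M \<pi>S R \<pi>A
    by unfold_locales (use assms in auto)
  have "feasible_flows M \<pi>S R K \<noteq> {}"
    using feasible_flow_attaining_occ[OF KL, of 0] by blast
  then have "Reach M \<pi>S R K \<le> 1"
    unfolding Reach_def by (rule cSUP_least) (rule flow_reach_le_1)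
  with reach_prob_le_Reach[OF KL] show ?thesis ..
qed

section \<open>The bisection\<close>

text \<open>The lower end of the interval never exceeds a threshold above which \<open>f\<close> is nonnegative, and the loop
  stops once the upper end is within \<open>\<epsilon>\<close> of the lower one.\<close>
lemma bisection_upper_bound:
  assumes "\<epsilon> > 0" and "lo \<le> L" and below: "\<And>K. f K < 0 \<Longrightarrow> K \<le> L"
  shows "snd (while (bisection_continue \<epsilon>) (bisection_step f) (lo, hi)) < L + \<epsilon>"
proof -
  obtain r where r: "while_option (bisection_continue \<epsilon>) (bisection_step f) (lo, hi) = Some r"
    using bisection_terminates[OF assms(1)] by blast
  have "fst r \<le> L"
  proof (rule while_option_rule[OF _ r, of "\<lambda>s. fst s \<le> L"])
    show "fst (bisection_step f s) \<le> L" if "fst s \<le> L" for s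
      using that below[of "(fst s + snd s) / 2"]
      by (auto simp: bisection_step_def Let_def case_prod_beta)
  qed (use assms in simp)
  moreover have "snd r - fst r < \<epsilon>"
    using while_option_stop[OF r] by (simp add: bisection_continue_def case_prod_beta)
  ultimately show ?thesis
    using r by (simp add: while_def)
qed

theorem theorem2:
  fixes n :: nat
    and M :: "nat \<Rightarrow> ('s, 'a) mdp"
    and \<pi>S :: "nat \<Rightarrow> 's \<Rightarrow> 'a pmf"
    and R :: "nat \<Rightarrow> 's set"
    and \<nu>A Kmax \<epsilon> :: real
  assumes "n \<ge> 1"
    and "\<And>i. i \<in> {1..n} \<Longrightarrow> finite_mdp (M i)"
    and "\<And>i. i \<in> {1..n} \<Longrightarrow> \<pi>S i \<in> policies (M i)"
    and "\<And>i. i \<in> {1..n} \<Longrightarrow> R i \<subseteq> states (M i)"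
    and "\<And>i s. i \<in> {1..n} \<Longrightarrow> s \<in> R i \<Longrightarrow> absorbing (M i) s"
    and "\<nu>A \<ge> 0"
    and "\<epsilon> > 0"
    and "optimal_KL n M \<pi>S R \<nu>A \<le> ereal Kmax"
  shows "ereal (deceptive_synthesis n M \<pi>S R \<nu>A Kmax \<epsilon>) < optimal_KL n M \<pi>S R \<nu>A + ereal \<epsilon>"
proof -
  let ?KL = "\<lambda>\<pi>A i. KL_div (path_measure (M i) (\<pi>A i)) (path_measure (M i) (\<pi>S i))"
  have le_Max: "?KL \<pi>A i \<le> (MAX i\<in>{1..n}. ?KL \<pi>A i)" if "i \<in> {1..n}" for \<pi>A i
    using that by (intro Max_ge) auto
  have sets: "sets (path_measure (M i) \<pi>) = sets (path_measure (M i) \<pi>')" for i \<pi> \<pi>'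
    by (simp only: path_measure_def sets_chain_measure)
  have "0 \<le> ?KL \<pi>A 1" for \<pi>A
    by (intro KL_div_nonneg prob_space_path_measure sets)
  then have "0 \<le> optimal_KL n M \<pi>S R \<nu>A"
    unfolding optimal_KL_def
    using le_Max[of 1] assms(1) by (intro INF_greatest) (meson atLeastAtMost_iff order_refl order_trans)
  then obtain L where L: "optimal_KL n M \<pi>S R \<nu>A = ereal L" and L_nonneg: "0 \<le> L"
    using assms(8) by (cases "optimal_KL n M \<pi>S R \<nu>A") auto
  have "K \<le> L" if gap: "reach_gap n M \<pi>S R \<nu>A K < 0" for K
  proof (rule ccontr)
    assume "\<not> K \<le> L"
    then have "optimal_KL n M \<pi>S R \<nu>A < ereal K" by (simp add: L)
    then obtain \<pi>A where \<pi>A: "\<forall>i\<in>{1..n}. \<pi>A i \<in> policies (M i)"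
      and team: "team_reach_prob n M \<pi>A R \<ge> \<nu>A" and max: "(MAX i\<in>{1..n}. ?KL \<pi>A i) < ereal K"
      unfolding optimal_KL_def INF_less_iff by (elim bexE CollectE conjE) (rule that)
    have Reach: "reach_prob (M i) (\<pi>A i) (R i) \<le> Reach (M i) (\<pi>S i) (R i) K \<and>
        Reach (M i) (\<pi>S i) (R i) K \<le> 1" if i: "i \<in> {1..n}" for i
    proof -
      interpret reach_mdp "M i" "\<pi>S i" "R i"
        by (rule reach_mdp.intro[OF assms(2)[OF i] assms(3)[OF i] assms(4)[OF i] assms(5)[OF i]])
      have "?KL \<pi>A i \<le> ereal K"
        by (rule order_trans[OF le_Max[OF i] less_imp_le[OF max]])
      with bspec[OF \<pi>A i] show ?thesis by (rule reach_prob_le_Reach_le_1)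
    qed
    have "(\<Prod>i\<in>{1..n}. 1 - Reach (M i) (\<pi>S i) (R i) K) \<le>
        (\<Prod>i\<in>{1..n}. 1 - reach_prob (M i) (\<pi>A i) (R i))"
    proof (rule prod_mono)
      show "0 \<le> 1 - Reach (M i) (\<pi>S i) (R i) K \<and>
          1 - Reach (M i) (\<pi>S i) (R i) K \<le> 1 - reach_prob (M i) (\<pi>A i) (R i)" if "i \<in> {1..n}" for i
        using Reach[OF that] by linarith
    qed
    then show False
      using team gap unfolding reach_gap_def team_reach_prob_def by linarith
  qed
  then have "deceptive_synthesis n M \<pi>S R \<nu>A Kmax \<epsilon> < L + \<epsilon>"
    unfolding deceptive_synthesis_def
    by (rule bisection_upper_bound[OF assms(7) L_nonneg])
  then show ?thesis by (simp add: L)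
qed

end
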